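(* Let $T>0$, $\Delta=\{(t,s)\in[0,T]^2 : 0\le s<t\le T\}$, let $(U,\rho)$ be a separable metric space and $u_0\in U$ fixed. Let $p\ge 1$ and $\beta\in(0,1)$. Let $f:\Delta\times\mathbb{R}^n\times U\to\mathbb{R}^n$ be measurable and suppose there are nonnegative functions $$L(\cdot)\in L^{(\frac1\beta\vee\frac{p}{p-1})+}(0,T;\mathbb{R}),\qquad L_0(\cdot)\in L^{(\frac{p}{1+\beta p}\vee 1)+}(0,T;\mathbb{R})$$ such that $$|f(t,s,y_1,u)-f(t,s,y_2,u)|\le\frac{L(s)|y_1-y_2|}{(t-s)^{1-\beta}},\qquad \forall (t,s,u)\in\Delta\times U,\ y_1,y_2\in\mathbb{R}^n,$$ $$|f(t,s,0,u)|\le\frac{L(s)\rho(u,u_0)+L_0(s)}{(t-s)^{1-\beta}},\qquad\forall (t,s,u)\in\Delta\times U.$$ Then for any $\eta(\cdot)\in L^p(0,T;\mathbb{R}^n)$ and $u(\cdot)\in\mathscr{U}^p[0,T]$, the integral equation $$y(t)=\eta(t)+\int_0^t f(t,s,y(s),u(s))\,ds,\qquad t\in[0,T],$$ admits a unique solution $y(\cdot)\in L^p(0,T;\mathbb{R}^n)$, and the following estimate holds: $$\|y(\cdot)\|_p\le \|\eta(\cdot)\|_p+K\big(1+\|\rho(u(\cdot),u_0)\|_p\big).$$ If $(\eta_1(\cdot),u_1(\cdot)),(\eta_2(\cdot),u_2(\cdot))\in L^p(0,T;\mathbb{R}^n)\times\mathscr{U}^p[0,T]$ and $y_1(\cdot),y_2(\cdot)$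 are the solutions of the integral equation corresponding to $(\eta_1(\cdot),u_1(\cdot))$ and $(\eta_2(\cdot),u_2(\cdot))$, respectively, then $$\|y_1(\cdot)-y_2(\cdot)\|_p\le K\Big\{\|\eta_1(\cdot)-\eta_2(\cdot)\|_p+\Big[\int_0^T\Big(\int_0^t|f(t,s,y_1(s),u_1(s))-f(t,s,y_1(s),u_2(s))|\,ds\Big)^p dt\Big]^{\frac1p}\Big\}.$$
   Context: $\|\cdot\|_p$ is the norm of $L^p(0,T)$. For $r\in[1,\infty)$, $L^{r+}(0,T;\mathbb{R})=\bigcup_{q>r}L^q(0,T;\mathbb{R})$. Convention for $p=1$: $\frac{1}{0}=\infty$, so $\frac{p}{p-1}=\infty$, and the condition on $L$ is read as $L(\cdot)\in L^\infty(0,T;\mathbb{R})$. $a\vee b=\max\{a,b\}$. $\mathscr{U}^p[0,T]$ is the set of measurable $u:[0,T]\to U$ with $\rho(u(\cdot),u_0)\in L^p(0,T;\mathbb{R})$. $K$ denotes a positive constant which may be different at different places.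
   Formalization: In the first estimate K may depend on an upper bound R for the norm of η (it is uniform in u and in all η of norm at most R); with K independent of η it fails, e.g. for f = y/(t-s)^{1-β}, u = u_0 and large constant η. *)

theory Defs
  imports "HOL-Analysis.Analysis"
begin

text \<open>
  Elements of \<open>L\<^sup>p(0,T)\<close> are represented by functions on \<open>real\<close>, of which only the values on
  \<open>{0..T}\<close> matter; equality in \<open>L\<^sup>p\<close> is equality almost everywhere.
\<close>

definition Lp :: "real \<Rightarrow> real \<Rightarrow> (real \<Rightarrow> 'a::euclidean_space) set" where
  "Lp T p = {g. g \<in> borel_measurable (lebesgue_on {0..T}) \<and>
                integrable (lebesgue_on {0..T}) (\<lambda>t. norm (g t) powr p)}"

definition Linf :: "real \<Rightarrow> (real \<Rightarrow> 'a::euclidean_space) set" where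
  "Linf T = {g. g \<in> borel_measurable (lebesgue_on {0..T}) \<and>
                (\<exists>C. AE t in lebesgue_on {0..T}. norm (g t) \<le> C)}"

definition Lp_norm :: "real \<Rightarrow> real \<Rightarrow> (real \<Rightarrow> 'a::euclidean_space) \<Rightarrow> real" where
  "Lp_norm T p g = (LINT t|lebesgue_on {0..T}. norm (g t) powr p) powr (1 / p)"

text \<open>
  The space \<open>L\<^sup>r\<^sup>+\<close>, with \<open>L\<^sup>\<infinity>\<^sup>+\<close> read as \<open>L\<^sup>\<infinity>\<close>. For finite \<open>r\<close> the union ranges over finite
  \<open>q\<close> only; \<open>L\<^sup>\<infinity>\<close> is contained in each of them since \<open>{0..T}\<close> has finite measure.
\<close>

definition Lp_plus :: "real \<Rightarrow> ereal \<Rightarrow> (real \<Rightarrow> 'a::euclidean_space) set" where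
  "Lp_plus T r = (if r = \<infinity> then Linf T else (\<Union>q\<in>{q. r < ereal q}. Lp T q))"

definition conj_exponent :: "real \<Rightarrow> ereal" where
  "conj_exponent p = (if p = 1 then \<infinity> else ereal (p / (p - 1)))"

definition Delta :: "real \<Rightarrow> (real \<times> real) set" where
  "Delta T = {(t, s). 0 \<le> s \<and> s < t \<and> t \<le> T}"

definition controls ::
    "real \<Rightarrow> real \<Rightarrow> 'u::{metric_space, second_countable_topology} \<Rightarrow> (real \<Rightarrow> 'u) set" where
  "controls T p u0 = {u. u \<in> measurable (lebesgue_on {0..T}) borel \<and>
                         (\<lambda>t. dist (u t) u0) \<in> Lp T p}"

text \<open>
  An element of \<open>L\<^sup>p\<close> solves the integral equation if the equation holds for almost every \<open>t\<close>.
  Existence of the integral is required explicitly, because the Bochner integral of a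
  non-integrable function is \<open>0\<close> by convention. The integral is over \<open>{0..<t}\<close>
  because \<open>(t, t)\<close> is not in \<open>Delta T\<close>.
\<close>

definition solves ::
    "real \<Rightarrow> (real \<Rightarrow> real \<Rightarrow> real ^ 'n \<Rightarrow> 'u \<Rightarrow> real ^ 'n) \<Rightarrow>
     (real \<Rightarrow> real ^ 'n) \<Rightarrow> (real \<Rightarrow> 'u) \<Rightarrow> (real \<Rightarrow> real ^ 'n) \<Rightarrow> bool" where
  "solves T f \<eta> u y \<longleftrightarrow>
     (AE t in lebesgue_on {0..T}.
        set_integrable lebesgue {0..<t} (\<lambda>s. f t s (y s) (u s)) \<and>
        y t = \<eta> t + (LINT s:{0..<t}|lebesgue. f t s (y s) (u s)))"

end

theory Submission
  imports Defs
begin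

text \<open>
  For \<open>a < 1 - b\<close> a three-factor Hoelder inequality with exponents \<open>1 - b - 1/p\<close>, \<open>b\<close>, \<open>1/p\<close>, applied to
  \<open>(t - s) powr (- a) * F s powr b * G s powr (1/p)\<close>, bounds the \<open>p\<close>-th power of the potential
  by a potential of \<open>G\<close> whose kernel is still integrable, and Tonelli then bounds its integral by that
  of \<open>G\<close>. This covers both \<open>L * |y|\<close> (with \<open>F = L powr q\<close>, \<open>b = 1/q\<close>) and \<open>L0\<close>
  (with \<open>F = G = L0 powr q\<close>, \<open>b = 1/q - 1/p\<close>); the assumptions on \<open>L\<close> and \<open>L0\<close> provide
  \<open>b < \<beta>\<close>, where \<open>1 - \<beta>\<close> is the order of the singularity. The slack in \<open>b < \<beta>\<close> is converted, by the weight \<open>exp (- l * t)\<close>, into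
  an arbitrarily small operator norm. Since the contraction constant is at our disposal,
  \<open>(x + y) powr p \<le> 2 powr p * (x powr p + y powr p)\<close> replaces Minkowski's inequality and a pointwise majorant of
  the Picard iteration replaces completeness of \<open>L\<^sup>p\<close>.
\<close>

section \<open>Weakly singular potentials\<close>

text \<open>Two obstacles shape the proof besides the estimates. Along \<open>y\<close> and
  \<open>u\<close> the integrand is only Lebesgue measurable on \<open>Delta T\<close>, and Lebesgue
  measure on the plane is the completion of a product, so a section in \<open>s\<close> is known to
  be measurable only for almost every \<open>t\<close>; measurability of the integral term goes
  through Borel versions and completeness. Moreover, constants must be uniform in \<eta>,
  \<open>u\<close> and \<open>y\<close>, which is why operator bounds are stored as predicates of a
  constant (\<open>pot_bounded\<close>, \<open>contraction_rate\<close>,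
  \<open>Gronwall_const\<close> and others) that quantify over the functions afterwards. The a
  priori bound with coefficient 1 before the norm of \<eta> has a \<open>K\<close> depending on a
  bound \<open>R\<close> of that norm: for f = y / (t - s) powr (1 - \<beta>), with
  \<open>L = 1\<close> and \<open>L0 = 0\<close>, the equation is linear and a nonzero constant
  \<eta> gives a solution of strictly larger norm, so scaling \<eta> rules out a \<open>K\<close>
  independent of it. What holds uniformly is a bound with one constant \<open>C\<close> in front of
  all terms.\<close>

text \<open>The tangent of \<open>exp\<close> at the weighted mean \<open>m\<close> of the
  logarithms lies below \<open>exp\<close>; averaging the three tangent bounds with the weights
  cancels their linear terms.\<close>

lemma weighted_AM_GM3:
  fixes x y z a b c :: real
  assumes "0 \<le> x" "0 \<le> y" "0 \<le> z" "0 \<le> a" "0 \<le> b" "0 \<le> c" "a + b + c = 1"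
  shows "x powr a * y powr b * z powr c \<le> a * x + b * y + c * z"
proof (cases "x = 0 \<or> y = 0 \<or> z = 0")
  case True
  \<comment> \<open>\<open>0 powr a\<close> is 0 for every exponent, also for \<open>a = 0\<close>,
    so one zero base annihilates the product.\<close>
  then have "x powr a * y powr b * z powr c = 0" by auto
  moreover have "0 \<le> a * x + b * y + c * z" using assms by (intro add_nonneg_nonneg mult_nonneg_nonneg)
  ultimately show ?thesis by (simp only:)
next
  case False
  then have pos: "x > 0" "y > 0" "z > 0" using assms by auto
  define m where "m = a * ln x + b * ln y + c * ln z"
  have 1: "exp m * (1 + (ln w - m)) \<le> w" if "w > 0" for w
  proof -
    have "exp m * (1 + (ln w - m)) \<le> exp m * exp (ln w - m)"
      by (intro mult_left_mono exp_ge_add_one_self) auto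
    also have "\<dots> = w" using that by (simp flip: exp_add)
    finally show ?thesis .
  qed
  have "exp m = exp m * (a * (1 + (ln x - m)) + b * (1 + (ln y - m)) + c * (1 + (ln z - m)))"
  proof -
    have "a * (1 + (ln x - m)) + b * (1 + (ln y - m)) + c * (1 + (ln z - m))
      = (a + b + c) * (1 - m) + m" by (simp add: m_def algebra_simps)
    then show ?thesis using assms by simp
  qed
  also have "\<dots> = a * (exp m * (1 + (ln x - m))) + b * (exp m * (1 + (ln y - m))) + c * (exp m * (1 + (ln z - m)))"
    by (simp add: algebra_simps)
  also have "\<dots> \<le> a * x + b * y + c * z"
    by (intro add_mono mult_left_mono 1 pos assms)
  finally show ?thesis using pos by (simp add: powr_def m_def exp_add mult.assoc)
qed

text \<open>Integrate the weighted mean inequality after dividing each function by a bound of its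
  integral. Positive upper bounds in place of the integrals make this division possible even if an
  integral vanishes.\<close>

lemma nn_integral_Holder3:
  fixes F1 F2 F3 :: "'a \<Rightarrow> real" and A B D :: real
  assumes [measurable]: "F1 \<in> borel_measurable M" "F2 \<in> borel_measurable M" "F3 \<in> borel_measurable M"
    and nn: "\<And>x. 0 \<le> F1 x" "\<And>x. 0 \<le> F2 x" "\<And>x. 0 \<le> F3 x"
    and abc: "0 \<le> a" "0 \<le> b" "0 \<le> c" "a + b + c = 1"
    and pos: "A > 0" "B > 0" "D > 0"
    and le: "(\<integral>\<^sup>+x. F1 x \<partial>M) \<le> A" "(\<integral>\<^sup>+x. F2 x \<partial>M) \<le> B" "(\<integral>\<^sup>+x. F3 x \<partial>M) \<le> D"
  shows "(\<integral>\<^sup>+x. F1 x powr a * F2 x powr b * F3 x powr c \<partial>M) \<le> ennreal (A powr a * B powr b * D powr c)"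
proof -
  define P where "P = A powr a * B powr b * D powr c"
  have P: "P \<ge> 0" by (simp add: P_def)
  have "(\<integral>\<^sup>+x. F1 x powr a * F2 x powr b * F3 x powr c \<partial>M)
     \<le> (\<integral>\<^sup>+x. ennreal (P * a / A) * F1 x + ennreal (P * b / B) * F2 x + ennreal (P * c / D) * F3 x \<partial>M)"
  proof (rule nn_integral_mono)
    fix x
    have "F1 x powr a * F2 x powr b * F3 x powr c
        = P * ((F1 x / A) powr a * (F2 x / B) powr b * (F3 x / D) powr c)"
      using pos nn by (simp add: P_def powr_divide)
    also have "\<dots> \<le> P * (a * (F1 x / A) + b * (F2 x / B) + c * (F3 x / D))"
      using pos nn abc P by (intro mult_left_mono weighted_AM_GM3) auto
    also have "\<dots> = (P * a / A) * F1 x + (P * b / B) * F2 x + (P * c / D) * F3 x"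
      by (simp add: algebra_simps)
    finally show "ennreal (F1 x powr a * F2 x powr b * F3 x powr c) \<le>
       ennreal (P * a / A) * F1 x + ennreal (P * b / B) * F2 x + ennreal (P * c / D) * F3 x"
      using pos nn abc P by (simp flip: ennreal_mult ennreal_plus add: ennreal_leI)
  qed
  also have "\<dots> = ennreal (P * a / A) * (\<integral>\<^sup>+x. F1 x \<partial>M) + ennreal (P * b / B) * (\<integral>\<^sup>+x. F2 x \<partial>M)
      + ennreal (P * c / D) * (\<integral>\<^sup>+x. F3 x \<partial>M)"
    by (simp add: nn_integral_add nn_integral_cmult)
  also have "\<dots> \<le> ennreal (P * a / A) * A + ennreal (P * b / B) * B + ennreal (P * c / D) * D"
    by (intro add_mono mult_left_mono le) auto
  also have "\<dots> = ennreal (P * (a + b + c))"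
    using pos abc(1-3) P by (simp flip: ennreal_mult ennreal_plus add: algebra_simps)
  finally show ?thesis using abc by (simp add: P_def)
qed

section \<open>Integrals of the kernel \<open>(t - s) powr (- a)\<close>\<close>

lemma nn_integral_powr_Icc:
  fixes a T :: real
  assumes "a < 1" "0 \<le> T"
  shows "(\<integral>\<^sup>+r. ennreal (r powr (- a)) * indicator {0..T} r \<partial>lborel) = ennreal (T powr (1 - a) / (1 - a))"
  using nn_integral_has_integral_lebesgue'[OF _ has_integral_powr_from_0[of "-a" T]] assms by simp

lemma sing_kernel_measurable [measurable]:
  fixes t :: real
  shows "(\<lambda>s. indicator {..<t} s * (t - s) powr (- a)) \<in> borel_measurable borel"
  by measurable

text \<open>Substitute r = t - s. The bound is the same for all \<open>t\<close>, so the kernel can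
  serve as a Hoelder factor at every \<open>t\<close>.\<close>

lemma nn_integral_sing_kernel_snd:
  fixes a T t :: real
  assumes "a < 1" "0 \<le> T" "t \<le> T"
  shows "(\<integral>\<^sup>+s. ennreal (indicator {..<t} s * (t - s) powr (- a)) \<partial>lebesgue_on {0..T})
    \<le> ennreal (T powr (1 - a) / (1 - a))"
proof -
  have "(\<integral>\<^sup>+s. ennreal (indicator {..<t} s * (t - s) powr (- a)) \<partial>lebesgue_on {0..T})
     = (\<integral>\<^sup>+s. ennreal (indicator {..<t} s * (t - s) powr (- a)) * indicator {0..T} s \<partial>lborel)"
    by (simp add: nn_integral_restrict_space nn_integral_completion)
  also have "\<dots> = (\<integral>\<^sup>+r. ennreal (indicator {..<t} (t - r) * (t - (t - r)) powr (- a)) * indicator {0..T} (t - r) \<partial>lborel)"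
    by (subst nn_integral_real_affine[where c="-1" and t=t]) auto
  also have "\<dots> \<le> (\<integral>\<^sup>+r. ennreal (r powr (- a)) * indicator {0..T} r \<partial>lborel)"
    using assms by (intro nn_integral_mono) (auto simp: indicator_def)
  finally show ?thesis using nn_integral_powr_Icc[of a T] assms by simp
qed

text \<open>The counterpart in the other variable: this is the inner integral after Tonelli, and its
  bound does not depend on \<open>s\<close>.\<close>

lemma nn_integral_sing_kernel_fst:
  fixes a T s :: real
  assumes "a < 1" "0 \<le> T" "0 \<le> s"
  shows "(\<integral>\<^sup>+t. ennreal (indicator {..<t} s * (t - s) powr (- a)) \<partial>lebesgue_on {0..T})
    \<le> ennreal (T powr (1 - a) / (1 - a))"
proof -
  have "(\<integral>\<^sup>+t. ennreal (indicator {..<t} s * (t - s) powr (- a)) \<partial>lebesgue_on {0..T})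
     = (\<integral>\<^sup>+t. ennreal (indicator {s<..} t * (t - s) powr (- a)) * indicator {0..T} t \<partial>lborel)"
    by (simp add: nn_integral_restrict_space nn_integral_completion indicator_def)
  also have "\<dots> = (\<integral>\<^sup>+r. ennreal (indicator {s<..} (s + r) * ((s + r) - s) powr (- a)) * indicator {0..T} (s + r) \<partial>lborel)"
    by (subst nn_integral_real_affine[where c="1" and t=s]) auto
  also have "\<dots> \<le> (\<integral>\<^sup>+r. ennreal (r powr (- a)) * indicator {0..T} r \<partial>lborel)"
    using assms by (intro nn_integral_mono) (auto simp: indicator_def)
  finally show ?thesis using nn_integral_powr_Icc[of a T] assms by simp
qed

text \<open>For nonnegative \<open>h\<close> and a < 1 this is, up to a Gamma factor, the
  Riemann-Liouville integral of order 1 - a. Values in \<open>ennreal\<close> make it meaningful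
  before any integrability is known; negative values of \<open>h\<close> are cut off at 0.\<close>

definition sing_pot :: "real \<Rightarrow> real \<Rightarrow> (real \<Rightarrow> real) \<Rightarrow> real \<Rightarrow> ennreal" where
  "sing_pot T a h t = (\<integral>\<^sup>+s. ennreal (indicator {..<t} s * (t - s) powr (- a) * h s) \<partial>lebesgue_on {0..T})"

lemma sigma_finite_lebesgue_Icc: "sigma_finite_measure (lebesgue_on {0..T::real})"
  by (intro finite_measure.axioms(1) finite_measure_lebesgue_on) auto

lemma sing_kernel_pair_measurable:
  assumes [measurable]: "h \<in> borel_measurable (lebesgue_on {0..T})"
  shows "(\<lambda>(t, s). ennreal (indicator {..<t} s * (t - s) powr (- a) * h s))
    \<in> borel_measurable (lebesgue_on {0..T} \<Otimes>\<^sub>M lebesgue_on {0..T})"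
proof -
  have [measurable]: "(\<lambda>s::real. s) \<in> lebesgue_on {0..T} \<rightarrow>\<^sub>M borel"
    using id_borel_measurable_lebesgue_on[of "{0..T}"] by (simp add: id_def)
  have [measurable]: "(\<lambda>x. indicator {..<fst x} (snd x) :: real)
      \<in> borel_measurable (lebesgue_on {0..T} \<Otimes>\<^sub>M lebesgue_on {0..T})"
    unfolding indicator_def lessThan_iff by measurable
  show ?thesis by (simp add: split_def)
qed

lemma sing_pot_measurable:
  assumes "h \<in> borel_measurable (lebesgue_on {0..T})"
  shows "sing_pot T a h \<in> borel_measurable (lebesgue_on {0..T})"
  unfolding sing_pot_def
  by (intro sigma_finite_measure.borel_measurable_nn_integral sigma_finite_lebesgue_Icc
      sing_kernel_pair_measurable assms)

text \<open>Tonelli leaves an inner integral of the kernel over \<open>t\<close>, bounded uniformly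
  in \<open>s\<close>: the case L^1 to L^1 of Young's inequality.\<close>

lemma nn_integral_sing_pot_le:
  assumes h[measurable]: "h \<in> borel_measurable (lebesgue_on {0..T})" and "a < 1" "0 \<le> T"
  shows "(\<integral>\<^sup>+t. sing_pot T a h t \<partial>lebesgue_on {0..T})
    \<le> ennreal (T powr (1 - a) / (1 - a)) * (\<integral>\<^sup>+s. ennreal (h s) \<partial>lebesgue_on {0..T})"
proof -
  interpret sigma_finite_measure "lebesgue_on {0..T}" by (rule sigma_finite_lebesgue_Icc)
  interpret pair_sigma_finite "lebesgue_on {0..T}" "lebesgue_on {0..T}" ..
  let ?M = "lebesgue_on {0..T}"
  have "(\<integral>\<^sup>+t. sing_pot T a h t \<partial>?M)
    = (\<integral>\<^sup>+s. (\<integral>\<^sup>+t. ennreal (indicator {..<t} s * (t - s) powr (- a) * h s) \<partial>?M) \<partial>?M)"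
    unfolding sing_pot_def
    by (rule Fubini'[symmetric]) (rule sing_kernel_pair_measurable, rule h)
  also have "\<dots> \<le> (\<integral>\<^sup>+s. ennreal (T powr (1 - a) / (1 - a)) * ennreal (h s) \<partial>?M)"
  proof (rule nn_integral_mono)
    fix s assume s: "s \<in> space ?M"
    have [measurable]: "(\<lambda>t::real. ennreal (indicator {..<t} s * (t - s) powr (- a))) \<in> borel_measurable ?M"
    proof -
      have "(\<lambda>t::real. ennreal (indicator {s<..} t * (t - s) powr (- a))) \<in> borel_measurable borel"
        by measurable
      then have "(\<lambda>t::real. ennreal (indicator {s<..} t * (t - s) powr (- a))) \<in> borel_measurable ?M"
        by (intro measurable_restrict_space1 measurable_completion) simp
      then show ?thesis by (simp add: indicator_def)
    qed
    have "(\<integral>\<^sup>+t. ennreal (indicator {..<t} s * (t - s) powr (- a) * h s) \<partial>?M)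
        = (\<integral>\<^sup>+t. ennreal (indicator {..<t} s * (t - s) powr (- a)) * ennreal (h s) \<partial>?M)"
      by (intro nn_integral_cong) (simp add: ennreal_mult')
    also have "\<dots> = (\<integral>\<^sup>+t. ennreal (indicator {..<t} s * (t - s) powr (- a)) \<partial>?M) * ennreal (h s)"
      by (rule nn_integral_multc) measurable
    also have "\<dots> \<le> ennreal (T powr (1 - a) / (1 - a)) * ennreal (h s)"
      using assms s by (intro mult_right_mono nn_integral_sing_kernel_fst) auto
    finally show "(\<integral>\<^sup>+t. ennreal (indicator {..<t} s * (t - s) powr (- a) * h s) \<partial>?M)
       \<le> ennreal (T powr (1 - a) / (1 - a)) * ennreal (h s)" .
  qed
  also have "\<dots> = ennreal (T powr (1 - a) / (1 - a)) * (\<integral>\<^sup>+s. ennreal (h s) \<partial>?M)"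
    by (rule nn_integral_cmult) measurable
  finally show ?thesis .
qed

lemma sing_pot_mono_AE:
  assumes "AE s in lebesgue_on {0..T}. h s \<le> g s"
  shows "sing_pot T a h t \<le> sing_pot T a g t"
  unfolding sing_pot_def using assms
  by (intro nn_integral_mono_AE) (auto elim!: eventually_mono intro!: ennreal_leI mult_left_mono)

text \<open>\<open>C\<close> comes before \<open>G\<close> and \<open>h\<close>, so it depends only
  on the exponents, \<open>T\<close> and \<open>F\<close>. The p-th power of the extended value
  \<open>sing_pot T a h t\<close> is expressed through all reals \<open>v\<close> below it; an
  infinite potential thus forces \<open>J t\<close> to be infinite, which later yields finiteness
  almost everywhere.\<close>

lemma sing_pot_bound:
  fixes T p a b :: real
  assumes "T > 0" "p \<ge> 1" "0 \<le> b" "b \<le> 1 - 1 / p" "a < 1 - b" "0 \<le> a"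
    and F[measurable]: "F \<in> borel_measurable (lebesgue_on {0..T})" and F0: "\<And>s. 0 \<le> F s"
    and Ffin: "(\<integral>\<^sup>+s. F s \<partial>lebesgue_on {0..T}) < \<infinity>"
  shows "\<exists>C>0::real. \<forall>G\<in>borel_measurable (lebesgue_on {0..T}). \<forall>h. (\<forall>s. 0 \<le> G s) \<longrightarrow>
      (AE s in lebesgue_on {0..T}. h s \<le> F s powr b * G s powr (1 / p)) \<longrightarrow>
      (\<exists>J\<in>borel_measurable (lebesgue_on {0..T}).
         (\<integral>\<^sup>+t. J t \<partial>lebesgue_on {0..T}) \<le> ennreal C * (\<integral>\<^sup>+s. ennreal (G s) \<partial>lebesgue_on {0..T}) \<and>
         (\<forall>t\<in>{0..T}. \<forall>v\<ge>0. ennreal v \<le> sing_pot T a h t \<longrightarrow> ennreal (v powr p) \<le> J t))"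
proof -
  let ?M = "lebesgue_on {0..T}"
  \<comment> \<open>The kernel is split with the exponents \<open>e\<close> and 1 / p, which sum to
    1 - b; hence its base must be (t - s) powr (- a'). The assumption a < 1 - b says exactly that a'
    < 1, so this base is integrable.\<close>
  define a' where "a' = a / (1 - b)"
  have b1: "1 - b > 0" using assms by linarith
  have a': "a' < 1" "a' * (1 - b) = a" using assms b1 by (auto simp: a'_def field_simps)
  define A where "A = T powr (1 - a') / (1 - a')"
  have A: "A > 0" using a' assms by (auto simp: A_def)
  obtain B0 where B0: "(\<integral>\<^sup>+s. F s \<partial>?M) = ennreal B0" "0 \<le> B0"
    using Ffin by (cases "\<integral>\<^sup>+s. F s \<partial>?M") auto
  \<comment> \<open>\<open>F\<close> may vanish almost everywhere, while the Hoelder bounds have to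
    be positive.\<close>
  define B where "B = B0 + 1"
  have B: "B > 0" "(\<integral>\<^sup>+s. F s \<partial>?M) \<le> ennreal B" using B0 by (auto simp: B_def intro: ennreal_leI)
  define e where "e = 1 - b - 1 / p"
  have e: "0 \<le> e" "0 \<le> 1 / p" "e + b + 1 / p = 1" using assms by (auto simp: e_def)
  define C1 where "C1 = (A powr e * B powr b) powr p"
  have C1: "C1 > 0" using A B by (simp add: C1_def)
  show ?thesis
  proof (intro exI[of _ "C1 * A"] conjI ballI allI impI)
    show "C1 * A > 0" using C1 A by simp
    fix G h
    assume G[measurable]: "G \<in> borel_measurable ?M" and G0: "\<forall>s. 0 \<le> G s"
      and h: "AE s in ?M. h s \<le> F s powr b * G s powr (1 / p)"
    let ?J = "\<lambda>t. ennreal C1 * sing_pot T a' G t"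
    show "\<exists>J\<in>borel_measurable ?M.
         (\<integral>\<^sup>+t. J t \<partial>?M) \<le> ennreal (C1 * A) * (\<integral>\<^sup>+s. ennreal (G s) \<partial>?M) \<and>
         (\<forall>t\<in>{0..T}. \<forall>v\<ge>0. ennreal v \<le> sing_pot T a h t \<longrightarrow> ennreal (v powr p) \<le> J t)"
    proof (intro bexI[of _ ?J] conjI ballI allI impI)
      note [measurable] = sing_pot_measurable[OF G]
      show "?J \<in> borel_measurable ?M" by measurable
      have "(\<integral>\<^sup>+t. ?J t \<partial>?M) = ennreal C1 * (\<integral>\<^sup>+t. sing_pot T a' G t \<partial>?M)"
        by (rule nn_integral_cmult) measurable
      also have "\<dots> \<le> ennreal C1 * (ennreal A * (\<integral>\<^sup>+s. ennreal (G s) \<partial>?M))"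
        unfolding A_def using assms a' by (intro mult_left_mono nn_integral_sing_pot_le) auto
      finally show "(\<integral>\<^sup>+t. ?J t \<partial>?M) \<le> ennreal (C1 * A) * (\<integral>\<^sup>+s. ennreal (G s) \<partial>?M)"
        using C1 A by (simp add: ennreal_mult mult.assoc)
    next
      fix t v :: real assume t: "t \<in> {0..T}" and v: "0 \<le> v" "ennreal v \<le> sing_pot T a h t"
      let ?k = "\<lambda>s. indicator {..<t} s * (t - s) powr (- a')"
      have [measurable]: "?k \<in> borel_measurable ?M"
        by (intro measurable_restrict_space1 measurable_completion) simp
      have k: "(\<integral>\<^sup>+s. ?k s \<partial>?M) \<le> ennreal A"
        unfolding A_def using t a' assms by (intro nn_integral_sing_kernel_snd) auto
      \<comment> \<open>\<open>D\<close> stands for any positive bound of the potential of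
        \<open>G\<close>, which may itself be 0.\<close>
      have main: "v powr p \<le> C1 * D" if D: "D > 0" "sing_pot T a' G t \<le> ennreal D" for D
      proof -
        have "ennreal v \<le> sing_pot T a (\<lambda>s. F s powr b * G s powr (1 / p)) t"
          using v(2) sing_pot_mono_AE[OF h] by (rule order_trans)
        \<comment> \<open>The three Hoelder functions are \<open>?k\<close>, \<open>F\<close> and
          \<open>?k * G\<close>, in this order.\<close>
        also have "\<dots> = (\<integral>\<^sup>+s. ?k s powr e * F s powr b * (?k s * G s) powr (1 / p) \<partial>?M)"
          unfolding sing_pot_def
        proof (intro nn_integral_cong arg_cong[of _ _ ennreal])
          fix s
          show "indicator {..<t} s * (t - s) powr (- a) * (F s powr b * G s powr (1 / p))
            = ?k s powr e * F s powr b * (?k s * G s) powr (1 / p)"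
          proof (cases "s < t")
            case True
            have "((t - s) powr (- a')) powr e * ((t - s) powr (- a')) powr (1 / p) = (t - s) powr (- a)"
              unfolding powr_powr powr_add[symmetric]
            proof (rule arg_cong[of _ _ "(powr) (t - s)"])
              have "- a' * e + - a' * (1 / p) = - (a' * (1 - b))" by (simp add: e_def algebra_simps)
              then show "- a' * e + - a' * (1 / p) = - a" using a' by simp
            qed
            then show ?thesis using True G0 by (simp add: powr_mult algebra_simps)
          qed auto
        qed
        also have "\<dots> \<le> ennreal (A powr e * B powr b * D powr (1 / p))"
          using e A B G0 F0 that assms k D(2)[unfolded sing_pot_def]
          by (intro nn_integral_Holder3) auto
        finally have "v \<le> A powr e * B powr b * D powr (1 / p)" by simp
        then have "v powr p \<le> (A powr e * B powr b * D powr (1 / p)) powr p"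
          using v assms by (intro powr_mono2) auto
        also have "\<dots> = C1 * D" using assms D by (simp add: C1_def powr_mult powr_powr)
        finally show ?thesis .
      qed
      show "ennreal (v powr p) \<le> ennreal C1 * sing_pot T a' G t"
      proof (cases "sing_pot T a' G t")
        case (real d)
        \<comment> \<open>Letting the positive excess \<open>x / C1\<close> tend to 0 replaces the
          bound \<open>D\<close> by \<open>d\<close>.\<close>
        have "v powr p \<le> C1 * d + x" if "x > 0" for x
        proof -
          have "v powr p \<le> C1 * (d + x / C1)"
            using real that C1 by (intro main) (auto intro!: ennreal_leI add_nonneg_pos)
          then show ?thesis using C1 by (simp add: distrib_left)
        qed
        then have "v powr p \<le> C1 * d" by (rule field_le_epsilon)
        then show ?thesis using real C1 by (simp flip: ennreal_mult add: ennreal_leI)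
      next
        case top
        then show ?thesis using C1 by (simp add: ennreal_mult_top)
      qed
    qed
  qed
qed

text \<open>With d \<le> 1 the constant 1 suffices: \<open>x powr d\<close> is at most 1 on the unit
  interval and at most \<open>x\<close> beyond it.\<close>

lemma powr_le_exp:
  fixes x d :: real
  assumes "x > 0" "0 \<le> d" "d \<le> 1"
  shows "x powr d \<le> exp x"
proof (cases "x \<le> 1")
  case True
  then have "x powr d \<le> 1" using assms by (intro powr_le1) auto
  also have "1 \<le> exp x" using assms by simp
  finally show ?thesis .
next
  case False
  then have "x powr d \<le> x powr 1" using assms by (intro powr_mono) auto
  also have "\<dots> \<le> exp x" using assms exp_gt_self[of x] by simp
  finally show ?thesis .
qed

text \<open>The exponential weight trades a small increase \<open>d\<close> of the singularity for a factor
  \<open>l powr (- d)\<close>, which tends to zero.\<close>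
lemma sing_pot_exp_weight:
  assumes [measurable]: "h \<in> borel_measurable (lebesgue_on {0..T})" and h0: "\<And>s. s \<in> {0..T} \<Longrightarrow> 0 \<le> h s"
    and l: "l > 0" and d: "0 \<le> d" "d \<le> 1" and v: "ennreal v \<le> sing_pot T a h t"
  shows "ennreal (l powr d * (exp (- l * t) * v)) \<le> sing_pot T (a + d) (\<lambda>s. exp (- l * s) * h s) t"
proof -
  let ?M = "lebesgue_on {0..T}"
  have [measurable]: "(\<lambda>s. indicator {..<t} s * (t - s) powr (- a)) \<in> borel_measurable ?M"
    by (intro measurable_restrict_space1 measurable_completion) simp
  have "ennreal (l powr d * (exp (- l * t) * v)) = ennreal (l powr d * exp (- l * t)) * ennreal v"
    by (subst ennreal_mult'[symmetric]) (auto simp: mult.assoc)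
  also have "\<dots> \<le> ennreal (l powr d * exp (- l * t)) * sing_pot T a h t"
    by (intro mult_left_mono v) auto
  also have "\<dots> = (\<integral>\<^sup>+s. ennreal (l powr d * exp (- l * t)) *
      ennreal (indicator {..<t} s * (t - s) powr (- a) * h s) \<partial>?M)"
    unfolding sing_pot_def by (rule nn_integral_cmult[symmetric]) measurable
  also have "\<dots> \<le> sing_pot T (a + d) (\<lambda>s. exp (- l * s) * h s) t"
    unfolding sing_pot_def
  proof (rule nn_integral_mono)
    fix s assume "s \<in> space ?M"
    then have hs: "0 \<le> h s" using h0 by simp
    show "ennreal (l powr d * exp (- l * t)) * ennreal (indicator {..<t} s * (t - s) powr (- a) * h s)
      \<le> ennreal (indicator {..<t} s * (t - s) powr (- (a + d)) * (exp (- l * s) * h s))"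
    proof (cases "s < t")
      case True
      \<comment> \<open>Since exp (- l * t) * exp (l * (t - s)) = exp (- l * s), this bound moves
        the weight inside the integral.\<close>
      have "(l * (t - s)) powr d \<le> exp (l * (t - s))" using True l d by (intro powr_le_exp) auto
      then have 1: "l powr d * (t - s) powr d \<le> exp (l * (t - s))" using True l by (simp add: powr_mult)
      have "l powr d * exp (- l * t) = (l powr d * (t - s) powr d) * (t - s) powr (- d) * exp (- l * t)"
        using True by (simp add: powr_minus)
      also have "\<dots> \<le> exp (l * (t - s)) * (t - s) powr (- d) * exp (- l * t)"
        by (intro mult_right_mono 1) auto
      also have "\<dots> = (t - s) powr (- d) * exp (- l * s)"
        by (simp add: algebra_simps flip: exp_add)
      finally have "l powr d * exp (- l * t) * ((t - s) powr (- a) * h s)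
         \<le> (t - s) powr (- d) * exp (- l * s) * ((t - s) powr (- a) * h s)"
        using hs by (intro mult_right_mono) auto
      also have "\<dots> = (t - s) powr (- (a + d)) * (exp (- l * s) * h s)"
        by (simp only: minus_add_distrib powr_add mult_ac)
      finally show ?thesis using True hs by (simp add: ennreal_leI flip: ennreal_mult)
    qed auto
  qed
  finally show ?thesis .
qed

section \<open>Lebesgue measurability\<close>

text \<open>Preimages under \<open>h\<close> and \<open>g\<close> differ by a subset of a null set,
  which completeness makes measurable.\<close>

lemma (in complete_measure) borel_measurable_AE_cong:
  assumes g: "g \<in> borel_measurable M" and eq: "AE x in M. h x = g x"
  shows "h \<in> borel_measurable M"
proof (rule measurableI)
  fix A :: "'b set" assume A: "A \<in> sets borel"
  show "h -` A \<inter> space M \<in> sets M"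
  proof (rule in_sets_AE)
    show "AE x in M. x \<in> g -` A \<inter> space M \<longleftrightarrow> x \<in> h -` A \<inter> space M"
      using eq by eventually_elim auto
    show "g -` A \<inter> space M \<in> sets M" using measurable_sets[OF g A] .
  qed auto
qed auto

lemma complete_measure_lebesgue_on:
  assumes "S \<in> sets lebesgue"
  shows "complete_measure (lebesgue_on S)"
proof
  fix A B assume "B \<subseteq> A" "A \<in> null_sets (lebesgue_on S)"
  then have "A \<in> null_sets lebesgue" "A \<subseteq> S"
    using assms null_sets_restrict_space[of S lebesgue A] by auto
  then have "B \<in> sets lebesgue" "B \<subseteq> S"
    using \<open>B \<subseteq> A\<close> completion.complete2 by blast+
  then show "B \<in> sets (lebesgue_on S)" using assms by (simp add: sets_restrict_space_iff)
qed

text \<open>Reduction to the real-valued coordinates. Fubini for a product of copies of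
  \<open>lborel\<close> is then applied to the Borel version.\<close>

lemma lebesgue_ex_borel_version:
  fixes g :: "'a::euclidean_space \<Rightarrow> 'b::euclidean_space"
  assumes g: "g \<in> borel_measurable lebesgue"
  obtains g' where "g' \<in> borel_measurable borel" "AE x in lborel. g x = g' x"
proof -
  have "\<exists>h\<in>borel_measurable lborel. AE x in lborel. g x \<bullet> b = h x" for b
    using g by (intro completion_ex_borel_measurable_real) simp
  then obtain h where h: "\<And>b. h b \<in> borel_measurable lborel" "\<And>b. AE x in lborel. g x \<bullet> b = h b x"
    by metis
  show thesis
  proof
    show "(\<lambda>x. \<Sum>b\<in>Basis. h b x *\<^sub>R b) \<in> borel_measurable borel"
      using h(1) by (auto intro!: borel_measurable_sum borel_measurable_scaleR)
    have "AE x in lborel. \<forall>b\<in>Basis. g x \<bullet> b = h b x"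
      using h(2) by (intro AE_finite_allI) auto
    then show "AE x in lborel. g x = (\<Sum>b\<in>Basis. h b x *\<^sub>R b)"
    proof eventually_elim
      case (elim x)
      have "g x = (\<Sum>b\<in>Basis. (g x \<bullet> b) *\<^sub>R b)" by (simp add: euclidean_representation)
      also have "\<dots> = (\<Sum>b\<in>Basis. h b x *\<^sub>R b)" using elim by (intro sum.cong) auto
      finally show ?case .
    qed
  qed
qed

text \<open>A state \<open>y\<close> is only Lebesgue measurable, so composing it with the
  projection to \<open>s\<close> requires preimages of null sets to be measurable; these are strips
  over null sets, hence null.\<close>

lemma snd_measurable_lebesgue: "(snd :: real \<times> real \<Rightarrow> real) \<in> lebesgue \<rightarrow>\<^sub>M lebesgue"
proof (rule completion.measurable_completion2)
  show m: "snd \<in> lebesgue \<rightarrow>\<^sub>M (lborel :: real measure)"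
    by (intro measurable_completion) (simp add: borel_prod[symmetric])
  show "null_sets lborel \<subseteq> null_sets (distr lebesgue lborel (snd :: real \<times> real \<Rightarrow> real))"
  proof
    fix N :: "real set" assume N: "N \<in> null_sets lborel"
    then have Nb: "N \<in> sets borel" and N0: "emeasure lborel N = 0" by (auto simp: null_sets_def)
    have "emeasure (lborel \<Otimes>\<^sub>M lborel) ((UNIV :: real set) \<times> N) = emeasure lborel (UNIV :: real set) * emeasure lborel N"
      using Nb by (intro lborel.emeasure_pair_measure_Times) auto
    then have "emeasure lborel ((UNIV :: real set) \<times> N) = 0" using N0 by (simp add: lborel_prod)
    moreover have "(UNIV :: real set) \<times> N \<in> sets borel"
      using Nb by (simp add: borel_Times)
    ultimately have "emeasure lebesgue ((UNIV :: real set) \<times> N) = 0" by simp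
    moreover have "snd -` N = (UNIV :: real set) \<times> N" by auto
    moreover have "emeasure (distr lebesgue lborel (snd :: real \<times> real \<Rightarrow> real)) N = emeasure lebesgue (snd -` N \<inter> space (lebesgue :: (real \<times> real) measure))"
      by (rule emeasure_distr[OF m]) (use Nb in simp)
    ultimately show "N \<in> null_sets (distr lebesgue lborel (snd :: real \<times> real \<Rightarrow> real))"
      using Nb by (simp add: null_sets_def)
  qed
qed

lemma nn_integral_le_sing_pot:
  assumes t: "t \<in> {0..T}" and le: "\<And>s. 0 \<le> s \<Longrightarrow> s < t \<Longrightarrow> norm (h s) \<le> g s * (t - s) powr (- a)"
  shows "(\<integral>\<^sup>+s. norm (indicator {0..<t} s *\<^sub>R h s) \<partial>lebesgue) \<le> sing_pot T a g t"
proof -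
  have "sing_pot T a g t = (\<integral>\<^sup>+s. ennreal (indicator {..<t} s * (t - s) powr (- a) * g s) * indicator {0..T} s \<partial>lebesgue)"
    by (simp add: sing_pot_def nn_integral_restrict_space)
  moreover have "(\<integral>\<^sup>+s. norm (indicator {0..<t} s *\<^sub>R h s) \<partial>lebesgue) \<le> \<dots>"
    using t le by (intro nn_integral_mono) (auto simp: indicator_def mult.commute intro!: ennreal_leI)
  ultimately show ?thesis by simp
qed

section \<open>The Volterra equation\<close>

text \<open>Telescoping and comparison with a geometric series. The explicit rate matters as much as
  the convergence: it is used pointwise with \<open>c = W t\<close> and then pulled out of the
  potential.\<close>

lemma geometric_steps_convergent:
  fixes x :: "nat \<Rightarrow> 'a::banach"
  assumes "\<And>n. norm (x (Suc n) - x n) \<le> c * (1 / 2) ^ n"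
  shows "x \<longlonglongrightarrow> lim x" "norm (lim x - x n) \<le> 2 * c * (1 / 2) ^ n"
proof -
  have sums: "(\<lambda>k. c * (1 / 2) ^ (k + n)) sums (2 * c * (1 / 2) ^ n)" for n
  proof -
    have "(\<lambda>k. (c * (1 / 2) ^ n) * (1 / 2) ^ k) sums ((c * (1 / 2) ^ n) * (1 / (1 - 1 / 2)))"
      by (intro sums_mult geometric_sums) simp
    moreover have "(c * (1 / 2) ^ n) * (1 / 2) ^ k = c * (1 / 2) ^ (k + n)" for k
      by (simp only: power_add mult_ac)
    moreover have "(c * (1 / 2) ^ n) * (1 / (1 - 1 / 2)) = 2 * c * (1 / 2) ^ n" by simp
    ultimately show ?thesis by (simp only:)
  qed
  have summ: "summable (\<lambda>k. norm (x (Suc (k + n)) - x (k + n)))" for n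
  proof (rule summable_comparison_test'[OF sums_summable[OF sums[of n]]])
    show "norm (norm (x (Suc (k + n)) - x (k + n))) \<le> c * (1 / 2) ^ (k + n)" for k
      unfolding real_norm_def abs_norm_cancel by (rule assms)
  qed
  have "summable (\<lambda>k. x (Suc (k + 0)) - x (k + 0))" by (rule summable_norm_cancel[OF summ])
  then have "convergent (\<lambda>n. \<Sum>k<n. x (Suc k) - x k)" unfolding add_0_right by (rule summable_iff_convergent[THEN iffD1])
  then obtain l where "(\<lambda>n. \<Sum>k<n. x (Suc k) - x k) \<longlonglongrightarrow> l" unfolding convergent_def by blast
  then have "(\<lambda>n. x n - x 0) \<longlonglongrightarrow> l" by (simp only: sum_lessThan_telescope)
  from tendsto_add[OF this tendsto_const[of "x 0"]] have "x \<longlonglongrightarrow> l + x 0" by simp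
  then show conv: "x \<longlonglongrightarrow> lim x" by (simp only: limI)
  have "(\<lambda>k. x (k + n)) \<longlonglongrightarrow> lim x" by (rule LIMSEQ_ignore_initial_segment[OF conv])
  from telescope_sums[OF this] have "(\<lambda>k. x (Suc (k + n)) - x (k + n)) sums (lim x - x n)" by simp
  then have "norm (lim x - x n) = norm (\<Sum>k. x (Suc (k + n)) - x (k + n))" by (simp only: sums_unique[symmetric])
  also have "\<dots> \<le> (\<Sum>k. norm (x (Suc (k + n)) - x (k + n)))" by (rule summable_norm[OF summ])
  also have "\<dots> \<le> (\<Sum>k. c * (1 / 2) ^ (k + n))"
    by (rule suminf_le[OF assms summ sums_summable[OF sums]])
  also have "\<dots> = 2 * c * (1 / 2) ^ n" by (rule sums_unique[OF sums, symmetric])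
  finally show "norm (lim x - x n) \<le> 2 * c * (1 / 2) ^ n" .
qed

text \<open>Returns from p-th powers to norms; x powr p and y powr p are both at most (x + y) powr
  p, whence the factor 2.\<close>

lemma le_root_mult_add:
  fixes a x y C p :: real
  assumes "a powr p \<le> C * (x powr p + y powr p)" "0 \<le> a" "0 \<le> x" "0 \<le> y" "0 \<le> C" "p \<ge> 1"
  shows "a \<le> (2 * C) powr (1 / p) * (x + y)"
proof -
  have "x powr p \<le> (x + y) powr p" "y powr p \<le> (x + y) powr p"
    using assms by (intro powr_mono2; simp)+
  then have "x powr p + y powr p \<le> 2 * (x + y) powr p" by simp
  then have "C * (x powr p + y powr p) \<le> C * (2 * (x + y) powr p)" using assms by (intro mult_left_mono)
  with assms(1) have "a powr p \<le> (2 * C) * (x + y) powr p" by (simp add: mult_ac)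
  then have "(a powr p) powr (1 / p) \<le> ((2 * C) * (x + y) powr p) powr (1 / p)"
    using assms by (intro powr_mono2) auto
  then show ?thesis using assms by (simp add: powr_powr powr_mult)
qed

lemma sing_pot_cmult_le:
  assumes [measurable]: "h \<in> borel_measurable (lebesgue_on {0..T})" and c: "0 \<le> c"
  shows "sing_pot T a (\<lambda>s. c * h s) t \<le> ennreal c * sing_pot T a h t"
proof -
  have [measurable]: "(\<lambda>s. indicator {..<t} s * (t - s) powr (- a)) \<in> borel_measurable (lebesgue_on {0..T})"
    by (intro measurable_restrict_space1 measurable_completion) simp
  have "sing_pot T a (\<lambda>s. c * h s) t
      = (\<integral>\<^sup>+s. ennreal c * ennreal (indicator {..<t} s * (t - s) powr (- a) * h s) \<partial>lebesgue_on {0..T})"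
    unfolding sing_pot_def using c by (intro nn_integral_cong) (simp add: mult_ac flip: ennreal_mult')
  also have "\<dots> = ennreal c * sing_pot T a h t"
    unfolding sing_pot_def by (rule nn_integral_cmult) measurable
  finally show ?thesis by simp
qed

locale volterra =
  fixes T p \<beta> :: real
    and u0 :: "'u::{metric_space, second_countable_topology}"
    and f :: "real \<Rightarrow> real \<Rightarrow> real ^ 'n \<Rightarrow> 'u \<Rightarrow> real ^ 'n"
    and L L0 :: "real \<Rightarrow> real"
  assumes T: "T > 0"
    and p: "p \<ge> 1"
    and \<beta>: "0 < \<beta>" "\<beta> < 1"
    and f_meas: "(\<lambda>((t, s), y, u). f t s y u)
        \<in> borel_measurable (lebesgue_on (Delta T) \<Otimes>\<^sub>M (borel \<Otimes>\<^sub>M borel))"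
    and L_nonneg: "\<And>s. s \<in> {0..T} \<Longrightarrow> L s \<ge> 0"
    and L0_nonneg: "\<And>s. s \<in> {0..T} \<Longrightarrow> L0 s \<ge> 0"
    and L: "L \<in> Lp_plus T (max (ereal (1 / \<beta>)) (conj_exponent p))"
    and L0: "L0 \<in> Lp_plus T (ereal (max (p / (1 + \<beta> * p)) 1))"
    and f_lipschitz: "\<And>t s u y1 y2. (t, s) \<in> Delta T \<Longrightarrow>
        norm (f t s y1 u - f t s y2 u) \<le> L s * norm (y1 - y2) / (t - s) powr (1 - \<beta>)"
    and f_growth: "\<And>t s u. (t, s) \<in> Delta T \<Longrightarrow>
        norm (f t s 0 u) \<le> (L s * dist u u0 + L0 s) / (t - s) powr (1 - \<beta>)"
begin

abbreviation "M \<equiv> lebesgue_on {0..T}"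

lemma Lp_nn_integral:
  assumes "g \<in> Lp T q"
  shows "g \<in> borel_measurable M" "(\<integral>\<^sup>+s. norm (g s) powr q \<partial>M) < \<infinity>"
  using assms by (auto simp: Lp_def integrable_iff_bounded)

lemma LpI:
  assumes "g \<in> borel_measurable M" "(\<integral>\<^sup>+s. norm (g s) powr q \<partial>M) < \<infinity>"
  shows "g \<in> Lp T q"
  using assms by (auto simp: Lp_def integrable_iff_bounded)

lemma emeasure_space_M: "emeasure M (space M) = ennreal T"
  using T by (simp add: emeasure_restrict_space)

lemma L_measurable [measurable]: "L \<in> borel_measurable M" and L0_measurable [measurable]: "L0 \<in> borel_measurable M"
  using L L0 by (auto simp: Lp_plus_def Lp_def Linf_def split: if_splits)

section \<open>\<open>L\<close> and \<open>L0\<close> through powers of integrable functions\<close>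

text \<open>An exponent q above 1 / \<beta> gives b = 1 / q < \<beta>, and one above the conjugate
  exponent keeps the Hoelder exponent 1 - b - 1 / p nonnegative.\<close>

lemma L_rep:
  obtains b c F where "0 \<le> b" "b < \<beta>" "b \<le> 1 - 1 / p" "0 < c" "F \<in> borel_measurable M"
    "\<And>s. 0 \<le> F s" "(\<integral>\<^sup>+s. ennreal (F s) \<partial>M) < \<infinity>" "AE s in M. L s \<le> c * F s powr b"
proof (cases "p = 1")
  case True
  then have "L \<in> Linf T" using L by (simp add: Lp_plus_def conj_exponent_def max_def)
  then obtain C where C: "AE t in M. norm (L t) \<le> C" by (auto simp: Linf_def)
  show thesis
  \<comment> \<open>For p = 1 only b = 0 is possible; \<open>L\<close> is bounded and its bound
    moves into \<open>c\<close>, where the maximum ensures positivity.\<close>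
  proof (rule that[of 0 "max 1 C" "\<lambda>_. 1"])
    show "(\<integral>\<^sup>+s. ennreal 1 \<partial>M) < \<infinity>"
      using emeasure_space_M by simp
    show "AE s in M. L s \<le> max 1 C * 1 powr 0"
      using C by eventually_elim auto
  qed (use True \<beta> in auto)
next
  case False
  then have "p > 1" using p by simp
  then have *: "max (ereal (1 / \<beta>)) (conj_exponent p) = ereal (max (1 / \<beta>) (p / (p - 1)))"
    by (simp add: conj_exponent_def)
  have "L \<in> (\<Union>q\<in>{q. ereal (max (1 / \<beta>) (p / (p - 1))) < ereal q}. Lp T q)"
    using L unfolding Lp_plus_def * by (simp del: ereal_max)
  then obtain q where q: "1 / \<beta> < q" "p / (p - 1) < q" "L \<in> Lp T q"
    by (auto simp del: ereal_max)
  have "0 < 1 / \<beta>" using \<beta> by simp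
  then have "q > 0" using q(1) by linarith
  have "q \<ge> p / (p - 1)" "p / (p - 1) > 0" using q \<open>p > 1\<close> by auto
  then have "1 / q \<le> 1 / (p / (p - 1))" using \<open>q > 0\<close> by (intro divide_left_mono mult_pos_pos) auto
  also have "\<dots> = 1 - 1 / p" using \<open>p > 1\<close> by (simp add: field_simps)
  finally have qp: "1 / q \<le> 1 - 1 / p" .
  show thesis
  proof (rule that[of "1 / q" 1 "\<lambda>s. norm (L s) powr q"])
    show "1 / q < \<beta>" using q \<beta> \<open>q > 0\<close> by (simp add: field_simps)
    show "AE s in M. L s \<le> 1 * (norm (L s) powr q) powr (1 / q)"
      using \<open>q > 0\<close> by (auto simp: powr_powr)
    show "(\<integral>\<^sup>+s. ennreal (norm (L s) powr q) \<partial>M) < \<infinity>" using Lp_nn_integral(2)[OF q(3)] by simp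
  qed (use qp \<open>q > 0\<close> in auto)
qed

lemma L0_rep:
  obtains b F G where "0 \<le> b" "b < \<beta>" "b \<le> 1 - 1 / p" "F \<in> borel_measurable M"
    "\<And>s. 0 \<le> F s" "(\<integral>\<^sup>+s. ennreal (F s) \<partial>M) < \<infinity>" "G \<in> borel_measurable M"
    "\<And>s. 0 \<le> G s" "(\<integral>\<^sup>+s. ennreal (G s) \<partial>M) < \<infinity>" 
    "AE s in M. L0 s \<le> F s powr b * G s powr (1 / p)"
proof -
  obtain q where q: "p / (1 + \<beta> * p) < q" "1 < q" "L0 \<in> Lp T q"
    using L0 unfolding Lp_plus_def by (auto simp del: ereal_max)
  \<comment> \<open>\<open>q\<close> may exceed \<open>p\<close>, and then 1 / q - 1 / p would be
    negative. Both \<open>p\<close> and \<open>q\<close> exceed p / (1 + \<beta> * p), which is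
    exactly what 1 / r - 1 / p < \<beta> asks of \<open>r\<close>.\<close>
  define r where "r = min p q"
  have pos: "0 < 1 + \<beta> * p" using p \<beta> by (simp add: add_pos_pos)
  have "p * (1 + \<beta> * p) > p * 1" using p \<beta> by (intro mult_strict_left_mono) auto
  then have "p / (1 + \<beta> * p) < p" using pos by (simp add: divide_less_eq)
  then have r: "1 \<le> r" "r \<le> p" "p / (1 + \<beta> * p) < r" "r \<le> q" using p q by (auto simp: r_def)
  have fin: "(\<integral>\<^sup>+s. norm (L0 s) powr r \<partial>M) < \<infinity>"
  proof -
    \<comment> \<open>The measure is finite, and a smaller power is dominated by 1 plus the larger
      one.\<close>
    have "(\<integral>\<^sup>+s. norm (L0 s) powr r \<partial>M) \<le> (\<integral>\<^sup>+s. 1 + ennreal (norm (L0 s) powr q) \<partial>M)"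
    proof (rule nn_integral_mono)
      fix s
      have "norm (L0 s) powr r \<le> 1 + norm (L0 s) powr q"
      proof (cases "norm (L0 s) \<le> 1")
        case True
        then have "norm (L0 s) powr r \<le> 1" using r by (intro powr_le1) auto
        then show ?thesis by (simp add: add_increasing2)
      next
        case False
        then have "norm (L0 s) powr r \<le> norm (L0 s) powr q" using r by (intro powr_mono) auto
        then show ?thesis by simp
      qed
      then have "ennreal (norm (L0 s) powr r) \<le> ennreal (1 + norm (L0 s) powr q)" by (rule ennreal_leI)
      then show "ennreal (norm (L0 s) powr r) \<le> 1 + ennreal (norm (L0 s) powr q)" by simp
    qed
    also have "\<dots> = ennreal T + (\<integral>\<^sup>+s. ennreal (norm (L0 s) powr q) \<partial>M)"
      using emeasure_space_M by (subst nn_integral_add) auto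
    also have "\<dots> < \<infinity>" using Lp_nn_integral(2)[OF q(3)] by simp
    finally show ?thesis .
  qed
  show thesis
  proof (rule that[of "1 / r - 1 / p" "\<lambda>s. norm (L0 s) powr r" "\<lambda>s. norm (L0 s) powr r"])
    show "0 \<le> 1 / r - 1 / p" using r p by (simp add: frac_le)
    have "p < r * (1 + \<beta> * p)" using r pos by (simp add: divide_less_eq)
    then show "1 / r - 1 / p < \<beta>" using r p by (simp add: field_simps)
    show "1 / r - 1 / p \<le> 1 - 1 / p" using r by simp
    show "AE s in M. L0 s \<le> (norm (L0 s) powr r) powr (1 / r - 1 / p) * (norm (L0 s) powr r) powr (1 / p)"
    proof (rule AE_I2)
      fix s
      have "(norm (L0 s) powr r) powr (1 / r - 1 / p) * (norm (L0 s) powr r) powr (1 / p) = norm (L0 s)"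
        unfolding powr_add[symmetric] using r by (simp add: powr_powr)
      then show "L0 s \<le> (norm (L0 s) powr r) powr (1 / r - 1 / p) * (norm (L0 s) powr r) powr (1 / p)"
        by simp
    qed
  qed (use fin in auto)
qed

section \<open>Bounds in L^p for the potentials\<close>

text \<open>Boundedness on L^p of the operator sending \<open>g\<close> to the potential of
  \<open>L * g\<close>, with C powr (1 / p) as a bound of its norm.\<close>

definition pot_bounded :: "real \<Rightarrow> real \<Rightarrow> bool" where
  "pot_bounded a C \<longleftrightarrow> 0 < C \<and> (\<forall>g\<in>borel_measurable M. (\<forall>s. 0 \<le> g s) \<longrightarrow>
     (\<exists>J\<in>borel_measurable M. (\<integral>\<^sup>+t. J t \<partial>M) \<le> ennreal C * (\<integral>\<^sup>+s. g s powr p \<partial>M) \<and>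
        (\<forall>t\<in>{0..T}. \<forall>v\<ge>0. ennreal v \<le> sing_pot T a (\<lambda>s. L s * g s) t \<longrightarrow> ennreal (v powr p) \<le> J t)))"

lemma pot_boundedD:
  assumes "pot_bounded a C" "g \<in> borel_measurable M" "\<And>s. 0 \<le> g s"
  obtains J where "J \<in> borel_measurable M" "(\<integral>\<^sup>+t. J t \<partial>M) \<le> ennreal C * (\<integral>\<^sup>+s. g s powr p \<partial>M)"
    "\<And>t v. t \<in> {0..T} \<Longrightarrow> v \<ge> 0 \<Longrightarrow> ennreal v \<le> sing_pot T a (\<lambda>s. L s * g s) t \<Longrightarrow> ennreal (v powr p) \<le> J t"
  using assms(1)[unfolded pot_bounded_def, THEN conjunct2, rule_format, OF assms(2,3)] by blast

text \<open>A slightly more singular kernel is still admissible because b < \<beta> is strict; the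
  excess \<open>d\<close> is what the exponential weight later spends.\<close>

lemma ex_pot_bounded:
  "\<exists>C. pot_bounded (1 - \<beta>) C" "\<exists>d C. 0 < d \<and> d \<le> 1 \<and> pot_bounded (1 - \<beta> + d) C"
proof -
  obtain b c F where bcF: "0 \<le> b" "b < \<beta>" "b \<le> 1 - 1 / p" "0 < c" "F \<in> borel_measurable M"
    "\<And>s. 0 \<le> F s" "(\<integral>\<^sup>+s. ennreal (F s) \<partial>M) < \<infinity>" "AE s in M. L s \<le> c * F s powr b"
    using L_rep by blast
  have *: "\<exists>C. pot_bounded a C" if a: "0 \<le> a" "a < 1 - b" for a
  proof -
    from sing_pot_bound[OF T p bcF(1,3) a(2,1) bcF(5-7)]
    obtain C where C: "C > 0" "\<And>G h. G \<in> borel_measurable M \<Longrightarrow> (\<forall>s. 0 \<le> G s) \<Longrightarrow>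
      (AE s in M. h s \<le> F s powr b * G s powr (1 / p)) \<Longrightarrow>
      (\<exists>J\<in>borel_measurable M. (\<integral>\<^sup>+t. J t \<partial>M) \<le> ennreal C * (\<integral>\<^sup>+s. ennreal (G s) \<partial>M) \<and>
         (\<forall>t\<in>{0..T}. \<forall>v\<ge>0. ennreal v \<le> sing_pot T a h t \<longrightarrow> ennreal (v powr p) \<le> J t))"
      by blast
    have "pot_bounded a (C * c powr p)"
      unfolding pot_bounded_def
    proof (intro conjI ballI impI)
      show "0 < C * c powr p" using C bcF by simp
      fix g :: "real \<Rightarrow> real" assume [measurable]: "g \<in> borel_measurable M" and g: "\<forall>s. 0 \<le> g s"
      \<comment> \<open>The constant \<open>c\<close> is absorbed into the function G = c powr p * g
        powr p and returns as a factor of the operator bound.\<close>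
      have "AE s in M. L s * g s \<le> F s powr b * (c powr p * g s powr p) powr (1 / p)"
        using bcF(8)
      proof eventually_elim
        case (elim s)
        have "L s * g s \<le> c * F s powr b * g s" using elim g by (intro mult_right_mono) auto
        also have "c * g s = (c powr p * g s powr p) powr (1 / p)"
          using bcF(4) g p by (simp add: powr_mult powr_powr)
        then have "c * F s powr b * g s = F s powr b * (c powr p * g s powr p) powr (1 / p)"
          by (simp add: mult_ac)
        finally show ?case .
      qed
      from C(2)[OF _ _ this] obtain J where J: "J \<in> borel_measurable M"
         "(\<integral>\<^sup>+t. J t \<partial>M) \<le> ennreal C * (\<integral>\<^sup>+s. ennreal (c powr p * g s powr p) \<partial>M)"
         "\<forall>t\<in>{0..T}. \<forall>v\<ge>0. ennreal v \<le> sing_pot T a (\<lambda>s. L s * g s) t \<longrightarrow> ennreal (v powr p) \<le> J t"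
        by (auto simp del: ennreal_mult)
      note J(2)
      also have "(\<integral>\<^sup>+s. ennreal (c powr p * g s powr p) \<partial>M) = ennreal (c powr p) * (\<integral>\<^sup>+s. g s powr p \<partial>M)"
        by (simp add: ennreal_mult nn_integral_cmult)
      also have "ennreal C * \<dots> = ennreal (C * c powr p) * (\<integral>\<^sup>+s. g s powr p \<partial>M)"
        using C(1) by (simp add: ennreal_mult mult.assoc)
      finally show "\<exists>J\<in>borel_measurable M. (\<integral>\<^sup>+t. J t \<partial>M) \<le> ennreal (C * c powr p) * (\<integral>\<^sup>+s. g s powr p \<partial>M) \<and>
        (\<forall>t\<in>{0..T}. \<forall>v\<ge>0. ennreal v \<le> sing_pot T a (\<lambda>s. L s * g s) t \<longrightarrow> ennreal (v powr p) \<le> J t)"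
        using J by blast
    qed
    then show ?thesis ..
  qed
  show "\<exists>C. pot_bounded (1 - \<beta>) C" using bcF \<beta> by (intro *) auto
  \<comment> \<open>Half of the gap between \<open>b\<close> and \<beta> keeps 1 - \<beta> + d below
    1 - b.\<close>
  define d where "d = (\<beta> - b) / 2"
  have "0 < d" "d \<le> 1" "1 - \<beta> + d < 1 - b" "0 \<le> 1 - \<beta> + d" using bcF \<beta> by (auto simp: d_def field_simps)
  then show "\<exists>d C. 0 < d \<and> d \<le> 1 \<and> pot_bounded (1 - \<beta> + d) C" using *[of "1 - \<beta> + d"] by blast
qed

lemma L0_pot_bound:
  obtains J where "J \<in> borel_measurable M" "(\<integral>\<^sup>+t. J t \<partial>M) < \<infinity>"
    "\<And>t v. t \<in> {0..T} \<Longrightarrow> v \<ge> 0 \<Longrightarrow> ennreal v \<le> sing_pot T (1 - \<beta>) L0 t \<Longrightarrow> ennreal (v powr p) \<le> J t"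
proof -
  obtain b F G where bFG: "0 \<le> b" "b < \<beta>" "b \<le> 1 - 1 / p" "F \<in> borel_measurable M"
    "\<And>s. 0 \<le> F s" "(\<integral>\<^sup>+s. ennreal (F s) \<partial>M) < \<infinity>" "G \<in> borel_measurable M"
    "\<And>s. 0 \<le> G s" "(\<integral>\<^sup>+s. ennreal (G s) \<partial>M) < \<infinity>" 
    "AE s in M. L0 s \<le> F s powr b * G s powr (1 / p)"
    using L0_rep by blast
  have "1 - \<beta> < 1 - b" "0 \<le> 1 - \<beta>" using bFG \<beta> by auto
  from sing_pot_bound[OF T p bFG(1,3) this bFG(4-6)]
  obtain C where "C > 0" and C: "\<forall>G\<in>borel_measurable M. \<forall>h. (\<forall>s. 0 \<le> G s) \<longrightarrow>
      (AE s in M. h s \<le> F s powr b * G s powr (1 / p)) \<longrightarrow>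
      (\<exists>J\<in>borel_measurable M. (\<integral>\<^sup>+t. J t \<partial>M) \<le> ennreal C * (\<integral>\<^sup>+s. ennreal (G s) \<partial>M) \<and>
         (\<forall>t\<in>{0..T}. \<forall>v\<ge>0. ennreal v \<le> sing_pot T (1 - \<beta>) h t \<longrightarrow> ennreal (v powr p) \<le> J t))"
    by auto
  have "\<forall>s. 0 \<le> G s" using bFG(8) by simp
  from C[rule_format, OF bFG(7) this[rule_format] bFG(10)] obtain J where J: "J\<in>borel_measurable M"
     "(\<integral>\<^sup>+t. J t \<partial>M) \<le> ennreal C * (\<integral>\<^sup>+s. ennreal (G s) \<partial>M)"
     "\<forall>t\<in>{0..T}. \<forall>v\<ge>0. ennreal v \<le> sing_pot T (1 - \<beta>) L0 t \<longrightarrow> ennreal (v powr p) \<le> J t"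
    by blast
  note J(2)
  also have "ennreal C * (\<integral>\<^sup>+s. ennreal (G s) \<partial>M) < \<infinity>"
    using bFG(9) by (simp add: ennreal_mult_less_top)
  finally show thesis using that J by blast
qed

text \<open>A value of the potential that is infinite would force the integrable majorant to be infinite.\<close>
lemma AE_sing_pot_finite:
  assumes [measurable]: "J \<in> borel_measurable M" and fin: "(\<integral>\<^sup>+t. J t \<partial>M) < \<infinity>"
    and J: "\<And>t v. t \<in> {0..T} \<Longrightarrow> v \<ge> 0 \<Longrightarrow> ennreal v \<le> sing_pot T a h t \<Longrightarrow> ennreal (v powr p) \<le> J t"
  shows "AE t in M. sing_pot T a h t < \<infinity>"
proof -
  have "AE t in M. J t \<noteq> \<infinity>" using fin by (intro nn_integral_PInf_AE) auto
  moreover have "AE t in M. t \<in> {0..T}" by (rule AE_I2) simp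
  ultimately show ?thesis
  proof eventually_elim
    case (elim t)
    show ?case
    proof (rule ccontr)
      assume "\<not> sing_pot T a h t < \<infinity>"
      then have top: "sing_pot T a h t = \<infinity>" by (simp add: not_less top_unique)
      obtain r where r: "J t = ennreal r" "0 \<le> r" using elim(1) by (cases "J t") auto
      \<comment> \<open>The real number with p-th power r + 1 lies below an infinite potential, so
        \<open>J t\<close>, which is r, would be at least r + 1.\<close>
      have "ennreal (((r + 1) powr (1 / p)) powr p) \<le> J t"
        using top elim(2) by (intro J) auto
      then show False using r p by (simp add: powr_powr)
    qed
  qed
qed

section \<open>Contraction in an exponentially weighted norm\<close>

text \<open>\<open>e\<close> bounds the p-th power of the operator norm in the space with weight exp
  (- l * t). The real function \<open>v\<close> stands for anything dominated by the potential, such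
  as the norm of a difference of integral terms.\<close>

definition contraction_rate :: "real \<Rightarrow> real \<Rightarrow> bool" where
  "contraction_rate e l \<longleftrightarrow> 0 < l \<and> (\<forall>g v. g \<in> borel_measurable M \<longrightarrow> (\<forall>s. 0 \<le> g s) \<longrightarrow> (\<forall>s. 0 \<le> v s) \<longrightarrow>
     (AE t in M. ennreal (v t) \<le> sing_pot T (1 - \<beta>) (\<lambda>s. L s * g s) t) \<longrightarrow>
     (\<integral>\<^sup>+t. (exp (- l * t) * v t) powr p \<partial>M) \<le> ennreal e * (\<integral>\<^sup>+t. (exp (- l * t) * g t) powr p \<partial>M))"

lemmas contraction_rate_pos = contraction_rate_def[THEN iffD1, THEN conjunct1]
lemmas contraction_rate_le = contraction_rate_def[THEN iffD1, THEN conjunct2, rule_format]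

lemma ex_contraction_rate:
  assumes "e > 0"
  shows "\<exists>l. contraction_rate e l"
proof -
  obtain d C where dC: "0 < d" "d \<le> 1" "pot_bounded (1 - \<beta> + d) C" using ex_pot_bounded by blast
  have "C > 0" using dC by (simp add: pot_bounded_def)
  \<comment> \<open>Solution of C / (l powr d) powr p = e: the weight gains l powr (- d), which
    enters with its p-th power.\<close>
  define l where "l = (C / e) powr (1 / (d * p))"
  have l: "l > 0" using \<open>C > 0\<close> assms by (simp add: l_def)
  have lC: "C = e * (l powr d) powr p"
    using \<open>C > 0\<close> assms dC p by (simp add: l_def powr_powr)
  show ?thesis
    unfolding contraction_rate_def
  proof (intro exI[of _ l] conjI allI impI l)
    fix g v :: "real \<Rightarrow> real" assume [measurable]: "g \<in> borel_measurable M" and g: "\<forall>s. 0 \<le> g s" and v: "\<forall>s. 0 \<le> v s"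
      and le: "AE t in M. ennreal (v t) \<le> sing_pot T (1 - \<beta>) (\<lambda>s. L s * g s) t"
    have [measurable]: "(\<lambda>s. exp (- l * s)) \<in> borel_measurable M"
      by (intro measurable_restrict_space1 measurable_completion) simp
    define g' where "g' = (\<lambda>s. exp (- l * s) * g s)"
    have g': "g' \<in> borel_measurable M" unfolding g'_def by measurable
    have g'0: "0 \<le> g' s" for s using g by (simp add: g'_def)
    obtain J where J: "J \<in> borel_measurable M"
      "(\<integral>\<^sup>+t. J t \<partial>M) \<le> ennreal C * (\<integral>\<^sup>+s. g' s powr p \<partial>M)"
      "\<And>t v. t \<in> {0..T} \<Longrightarrow> v \<ge> 0 \<Longrightarrow> ennreal v \<le> sing_pot T (1 - \<beta> + d) (\<lambda>s. L s * g' s) t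
         \<Longrightarrow> ennreal (v powr p) \<le> J t"
      using pot_boundedD[OF dC(3) g' g'0] by blast
    define k where "k = (l powr d) powr p"
    have k: "k > 0" "C = e * k" using l lC by (auto simp: k_def)
    have "(\<integral>\<^sup>+t. (exp (- l * t) * v t) powr p \<partial>M) \<le> (\<integral>\<^sup>+t. ennreal (1 / k) * J t \<partial>M)"
    proof (rule nn_integral_mono_AE)
      have "AE t in M. t \<in> {0..T}" by (rule AE_I2) simp
      with le show "AE t in M. (exp (- l * t) * v t) powr p \<le> ennreal (1 / k) * J t"
      proof eventually_elim
        case (elim t)
        have "ennreal (l powr d * (exp (- l * t) * v t))
            \<le> sing_pot T (1 - \<beta> + d) (\<lambda>s. exp (- l * s) * (L s * g s)) t"
          using elim l dC g L_nonneg by (intro sing_pot_exp_weight) auto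
        then have "ennreal ((l powr d * (exp (- l * t) * v t)) powr p) \<le> J t"
          using elim(2) v by (intro J(3)) (auto simp: mult_ac g'_def)
        then have "ennreal (1 / k) * ennreal (k * (exp (- l * t) * v t) powr p) \<le> ennreal (1 / k) * J t"
          using v by (intro mult_left_mono) (auto simp: powr_mult k_def)
        then show ?case using k by (simp flip: ennreal_mult)
      qed
    qed
    also have "\<dots> = ennreal (1 / k) * (\<integral>\<^sup>+t. J t \<partial>M)" using J(1) by (rule nn_integral_cmult)
    also have "\<dots> \<le> ennreal (1 / k) * (ennreal C * (\<integral>\<^sup>+t. g' t powr p \<partial>M))"
      by (intro mult_left_mono J(2)) auto
    also have "\<dots> = ennreal (1 / k * C) * (\<integral>\<^sup>+t. g' t powr p \<partial>M)"
      using k \<open>C > 0\<close> by (subst ennreal_mult) (auto simp: mult.assoc)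
    also have "1 / k * C = e" using k by simp
    finally show "(\<integral>\<^sup>+t. (exp (- l * t) * v t) powr p \<partial>M) \<le> ennreal e * (\<integral>\<^sup>+t. (exp (- l * t) * g t) powr p \<partial>M)"
      by (simp only: g'_def)
  qed
qed

section \<open>Measurability and integrability of the integral term\<close>

lemma complete_M: "complete_measure M"
  by (rule complete_measure_lebesgue_on) simp

lemma AE_M_Icc: "AE t in M. t \<in> {0..T}"
  by (rule AE_I2) simp

lemma Delta_borel: "Delta T \<in> sets borel"
proof -
  have "{x \<in> space borel. 0 \<le> snd x \<and> snd x < fst x \<and> fst x \<le> T} \<in> sets (borel :: (real \<times> real) measure)"
    unfolding borel_prod[symmetric] by measurable
  moreover have "Delta T = {x \<in> space borel. 0 \<le> snd x \<and> snd x < fst x \<and> fst x \<le> T}"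
    by (auto simp: Delta_def)
  ultimately show ?thesis by simp
qed

text \<open>Parameter integrals of a Borel function of (t, s) are measurable by Fubini. A null set
  of the plane has null sections for almost every \<open>t\<close>, hence the two nested
  almost-everywhere quantifiers.\<close>

lemma f_borel_version:
  assumes y: "y \<in> borel_measurable M" and u: "u \<in> M \<rightarrow>\<^sub>M borel"
  obtains \<phi> :: "real \<times> real \<Rightarrow> real ^ 'n" where "\<phi> \<in> borel_measurable borel"
    "AE t in M. AE s in lborel. indicator {0..<t} s *\<^sub>R f t s (y s) (u s) = \<phi> (t, s)"
proof -
  let ?D = "lebesgue_on (Delta T)"
  have D: "Delta T \<in> sets lebesgue" using Delta_borel by simp
  have snd: "snd \<in> ?D \<rightarrow>\<^sub>M M"
    by (intro measurable_restrict_space3 snd_measurable_lebesgue) (auto simp: Delta_def)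
  \<comment> \<open>The first component keeps the Lebesgue sigma-algebra of \<open>Delta T\<close>,
    for which \<open>f\<close> is assumed measurable; the other two have Borel targets.\<close>
  have "(\<lambda>x. (x, y (snd x), u (snd x))) \<in> ?D \<rightarrow>\<^sub>M ?D \<Otimes>\<^sub>M (borel \<Otimes>\<^sub>M borel)"
    by (intro measurable_Pair measurable_ident[unfolded id_def] measurable_compose[OF snd y] measurable_compose[OF snd u])
  from measurable_compose[OF this f_meas]
  have "(\<lambda>x. f (fst x) (snd x) (y (snd x)) (u (snd x))) \<in> borel_measurable ?D"
    by (simp add: split_def)
  then have "(\<lambda>x. if x \<in> Delta T then f (fst x) (snd x) (y (snd x)) (u (snd x)) else 0) \<in> borel_measurable lebesgue"
    using D by (simp add: borel_measurable_if)
  then obtain \<phi> where \<phi>: "\<phi> \<in> borel_measurable borel"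
    "AE x in lborel. (if x \<in> Delta T then f (fst x) (snd x) (y (snd x)) (u (snd x)) else 0) = \<phi> x"
    by (rule lebesgue_ex_borel_version)
  have "AE t in lborel. AE s in lborel.
      (if (t, s) \<in> Delta T then f t s (y s) (u s) else 0) = \<phi> (t, s)"
    using lborel_pair.AE_pair[OF \<phi>(2)[unfolded lborel_prod[symmetric]]] unfolding fst_conv snd_conv .
  then have "AE t in M. AE s in lborel. (if (t, s) \<in> Delta T then f t s (y s) (u s) else 0) = \<phi> (t, s)"
    by (auto simp: AE_restrict_space_iff AE_completion_iff elim: eventually_mono)
  with AE_M_Icc have "AE t in M. AE s in lborel. indicator {0..<t} s *\<^sub>R f t s (y s) (u s) = \<phi> (t, s)"
  proof eventually_elim
    case (elim t)
    then show ?case by (auto simp: Delta_def indicator_def elim!: eventually_mono)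
  qed
  with \<phi>(1) show thesis by (rule that)
qed

text \<open>Sections of the Borel version are measurable for all \<open>t\<close>; for almost every
  \<open>t\<close> completeness passes this on to the integrand.\<close>

lemma f_section_measurable:
  assumes y: "y \<in> borel_measurable M" and u: "u \<in> M \<rightarrow>\<^sub>M borel"
  shows "AE t in M. (\<lambda>s. indicator {0..<t} s *\<^sub>R f t s (y s) (u s)) \<in> borel_measurable lebesgue"
proof -
  obtain \<phi> where \<phi>: "\<phi> \<in> borel_measurable borel"
    "AE t in M. AE s in lborel. indicator {0..<t} s *\<^sub>R f t s (y s) (u s) = \<phi> (t, s)"
    using f_borel_version[OF y u] .
  have "(\<lambda>s. \<phi> (t, s)) \<in> borel_measurable lebesgue" for t
    using \<phi>(1) by (intro measurable_completion) (simp add: borel_prod[symmetric] measurable_Pair1')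
  then show ?thesis
    using \<phi>(2) by (auto intro: completion.borel_measurable_AE_cong AE_completion elim!: eventually_mono)
qed

lemma f_bound:
  assumes "(t, s) \<in> Delta T"
  shows "norm (f t s y u) \<le> (L s * (norm y + dist u u0) + L0 s) * (t - s) powr (- (1 - \<beta>))"
proof -
  have "norm (f t s y u) \<le> norm (f t s y u - f t s 0 u) + norm (f t s 0 u)"
    by (metis diff_add_cancel norm_triangle_ineq)
  also have "\<dots> \<le> L s * norm (y - 0) / (t - s) powr (1 - \<beta>) + (L s * dist u u0 + L0 s) / (t - s) powr (1 - \<beta>)"
    by (intro add_mono f_lipschitz f_growth assms)
  also have "\<dots> = (L s * (norm y + dist u u0) + L0 s) / (t - s) powr (1 - \<beta>)"
    by (simp add: algebra_simps add_divide_distrib)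
  finally show ?thesis by (simp only: powr_minus divide_inverse)
qed

lemma f_lip:
  assumes "(t, s) \<in> Delta T"
  shows "norm (f t s y1 u - f t s y2 u) \<le> (L s * norm (y1 - y2)) * (t - s) powr (- (1 - \<beta>))"
  using f_lipschitz[OF assms] by (simp only: powr_minus divide_inverse)

definition V :: "(real \<Rightarrow> real ^ 'n) \<Rightarrow> (real \<Rightarrow> 'u) \<Rightarrow> real \<Rightarrow> real ^ 'n" where
  "V y u t = (LINT s:{0..<t}|lebesgue. f t s (y s) (u s))"

text \<open>It dominates the norm of \<open>V\<close>, and a sum of two of them dominates
  \<open>DV\<close>, so one L^p bound serves both.\<close>

definition NV :: "(real \<Rightarrow> real ^ 'n) \<Rightarrow> (real \<Rightarrow> 'u) \<Rightarrow> real \<Rightarrow> real" where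
  "NV y u t = (LINT s:{0..<t}|lebesgue. norm (f t s (y s) (u s)))"

text \<open>The inner integral of the stability estimate: the control changes while the state stays
  the same.\<close>

definition DV :: "(real \<Rightarrow> real ^ 'n) \<Rightarrow> (real \<Rightarrow> 'u) \<Rightarrow> (real \<Rightarrow> 'u) \<Rightarrow> real \<Rightarrow> real" where
  "DV y u v t = (LINT s:{0..<t}|lebesgue. norm (f t s (y s) (u s) - f t s (y s) (v s)))"

lemma Lp_measurable: "y \<in> Lp T q \<Longrightarrow> y \<in> borel_measurable M"
  by (simp add: Lp_def)

lemma controlsD:
  assumes "u \<in> controls T p u0"
  shows "u \<in> M \<rightarrow>\<^sub>M borel" "(\<lambda>t. dist (u t) u0) \<in> Lp T p"
  using assms by (auto simp: controls_def)

lemma powr_add_le: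
  fixes x y :: real
  assumes "0 \<le> x" "0 \<le> y"
  shows "(x + y) powr p \<le> 2 powr p * (x powr p + y powr p)"
proof -
  have "(x + y) powr p \<le> (2 * max x y) powr p" using assms p by (intro powr_mono2) auto
  also have "\<dots> = 2 powr p * (max x y) powr p" using assms by (simp add: powr_mult)
  also have "\<dots> \<le> 2 powr p * (x powr p + y powr p)" by (intro mult_left_mono) (auto simp: max_def)
  finally show ?thesis .
qed

lemma nn_integral_powr_add_le:
  fixes g h :: "real \<Rightarrow> real"
  assumes [measurable]: "g \<in> borel_measurable M" "h \<in> borel_measurable M" and "\<And>s. 0 \<le> g s" "\<And>s. 0 \<le> h s"
  shows "(\<integral>\<^sup>+s. (g s + h s) powr p \<partial>M)
    \<le> ennreal (2 powr p) * ((\<integral>\<^sup>+s. g s powr p \<partial>M) + (\<integral>\<^sup>+s. h s powr p \<partial>M))"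
proof -
  have "(\<integral>\<^sup>+s. (g s + h s) powr p \<partial>M) \<le> (\<integral>\<^sup>+s. ennreal (2 powr p) * (ennreal (g s powr p) + ennreal (h s powr p)) \<partial>M)"
    using assms(3,4) powr_add_le by (intro nn_integral_mono) (simp flip: ennreal_plus ennreal_mult add: ennreal_leI)
  also have "\<dots> = ennreal (2 powr p) * ((\<integral>\<^sup>+s. g s powr p \<partial>M) + (\<integral>\<^sup>+s. h s powr p \<partial>M))"
    by (simp add: nn_integral_cmult nn_integral_add)
  finally show ?thesis .
qed

lemma f_nn_integral_le:
  assumes t: "t \<in> {0..T}"
  shows "(\<integral>\<^sup>+s. norm (indicator {0..<t} s *\<^sub>R f t s (y s) (u s)) \<partial>lebesgue)
    \<le> sing_pot T (1 - \<beta>) (\<lambda>s. L s * (norm (y s) + dist (u s) u0) + L0 s) t"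
  using t by (intro nn_integral_le_sing_pot f_bound) (auto simp: Delta_def)

text \<open>The summand 1 carries the share of \<open>L0\<close>, which does not scale with
  \<open>g\<close>.\<close>

definition source_bounded :: "real \<Rightarrow> bool" where
  "source_bounded C \<longleftrightarrow> 0 < C \<and> (\<forall>g\<in>borel_measurable M. (\<forall>s. 0 \<le> g s) \<longrightarrow>
    (\<exists>J\<in>borel_measurable M. (\<integral>\<^sup>+t. J t \<partial>M) \<le> ennreal C * (1 + (\<integral>\<^sup>+s. g s powr p \<partial>M)) \<and>
      (\<forall>t\<in>{0..T}. \<forall>v\<ge>0. ennreal v \<le> sing_pot T (1 - \<beta>) (\<lambda>s. L s * g s + L0 s) t \<longrightarrow> ennreal (v powr p) \<le> J t)))"

lemma source_boundedD:
  assumes "source_bounded C" "g \<in> borel_measurable M" "\<And>s. 0 \<le> g s"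
  obtains J where "J \<in> borel_measurable M" "(\<integral>\<^sup>+t. J t \<partial>M) \<le> ennreal C * (1 + (\<integral>\<^sup>+s. g s powr p \<partial>M))"
    "\<And>t v. t \<in> {0..T} \<Longrightarrow> v \<ge> 0 \<Longrightarrow> ennreal v \<le> sing_pot T (1 - \<beta>) (\<lambda>s. L s * g s + L0 s) t \<Longrightarrow> ennreal (v powr p) \<le> J t"
  using assms(1)[unfolded source_bounded_def, THEN conjunct2, rule_format, OF assms(2,3)] by blast

text \<open>The potential of a sum is split because \<open>L\<close> and \<open>L0\<close> have different integrability.\<close>
lemma ex_source_bounded: "\<exists>C. source_bounded C"
proof -
  obtain C1 where C1: "pot_bounded (1 - \<beta>) C1" using ex_pot_bounded by blast
  then have "C1 > 0" by (simp add: pot_bounded_def)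
  obtain J0 where J0 [measurable]: "J0 \<in> borel_measurable M" and J0fin: "(\<integral>\<^sup>+t. J0 t \<partial>M) < \<infinity>"
    and J0v: "\<And>t v. t \<in> {0..T} \<Longrightarrow> v \<ge> 0 \<Longrightarrow> ennreal v \<le> sing_pot T (1 - \<beta>) L0 t \<Longrightarrow> ennreal (v powr p) \<le> J0 t"
    using L0_pot_bound by blast
  obtain C0 where C0: "(\<integral>\<^sup>+t. J0 t \<partial>M) = ennreal C0" "0 \<le> C0"
    using J0fin by (cases "\<integral>\<^sup>+t. J0 t \<partial>M") auto
  define C where "C = 2 powr p * (C1 + C0)"
  show ?thesis
    unfolding source_bounded_def
  proof (intro exI[of _ C] conjI ballI impI)
    show "C > 0" using \<open>C1 > 0\<close> C0 by (simp add: C_def)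
    fix g :: "real \<Rightarrow> real" assume g[measurable]: "g \<in> borel_measurable M" and "\<forall>s. 0 \<le> g s"
    then have g0: "\<And>s. 0 \<le> g s" by simp
    obtain J1 where J1 [measurable]: "J1 \<in> borel_measurable M"
      and J1i: "(\<integral>\<^sup>+t. J1 t \<partial>M) \<le> ennreal C1 * (\<integral>\<^sup>+s. g s powr p \<partial>M)"
      and J1v: "\<And>t v. t \<in> {0..T} \<Longrightarrow> v \<ge> 0 \<Longrightarrow> ennreal v \<le> sing_pot T (1 - \<beta>) (\<lambda>s. L s * g s) t \<Longrightarrow> ennreal (v powr p) \<le> J1 t"
      using pot_boundedD[OF C1 g g0] by blast
    have split: "sing_pot T (1 - \<beta>) (\<lambda>s. L s * g s + L0 s) t \<le> sing_pot T (1 - \<beta>) (\<lambda>s. L s * g s) t + sing_pot T (1 - \<beta>) L0 t" for t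
    proof -
      have [measurable]: "(\<lambda>s. indicator {..<t} s * (t - s) powr (- (1 - \<beta>))) \<in> borel_measurable M"
        by (intro measurable_restrict_space1 measurable_completion) simp
      have "sing_pot T (1 - \<beta>) (\<lambda>s. L s * g s) t + sing_pot T (1 - \<beta>) L0 t
        = (\<integral>\<^sup>+s. ennreal (indicator {..<t} s * (t - s) powr (- (1 - \<beta>)) * (L s * g s))
             + ennreal (indicator {..<t} s * (t - s) powr (- (1 - \<beta>)) * L0 s) \<partial>M)"
        unfolding sing_pot_def by (rule nn_integral_add[symmetric]) measurable
      also have "\<dots> \<ge> sing_pot T (1 - \<beta>) (\<lambda>s. L s * g s + L0 s) t"
        unfolding sing_pot_def using L_nonneg L0_nonneg g0
        by (intro nn_integral_mono) (auto simp: distrib_left simp flip: ennreal_plus)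
      finally show ?thesis .
    qed
    show "\<exists>J\<in>borel_measurable M. (\<integral>\<^sup>+t. J t \<partial>M) \<le> ennreal C * (1 + (\<integral>\<^sup>+s. g s powr p \<partial>M)) \<and>
      (\<forall>t\<in>{0..T}. \<forall>v\<ge>0. ennreal v \<le> sing_pot T (1 - \<beta>) (\<lambda>s. L s * g s + L0 s) t \<longrightarrow> ennreal (v powr p) \<le> J t)"
    proof (intro bexI[of _ "\<lambda>t. ennreal (2 powr p) * (J1 t + J0 t)"] conjI ballI allI impI)
      have "(\<integral>\<^sup>+t. ennreal (2 powr p) * (J1 t + J0 t) \<partial>M) = ennreal (2 powr p) * ((\<integral>\<^sup>+t. J1 t \<partial>M) + (\<integral>\<^sup>+t. J0 t \<partial>M))"
        by (simp add: nn_integral_cmult nn_integral_add)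
      also have "\<dots> \<le> ennreal (2 powr p) * (ennreal (C1 + C0) * (\<integral>\<^sup>+s. g s powr p \<partial>M) + ennreal (C1 + C0) * 1)"
        using C0 \<open>C1 > 0\<close> by (intro mult_left_mono add_mono order_trans[OF J1i] mult_right_mono) (auto intro: ennreal_leI)
      also have "\<dots> = ennreal C * (1 + (\<integral>\<^sup>+s. g s powr p \<partial>M))"
      proof -
        have "ennreal C = ennreal (2 powr p) * ennreal (C1 + C0)"
          unfolding C_def using C0 \<open>C1 > 0\<close> by (intro ennreal_mult) auto
        then show ?thesis by (simp only: distrib_left mult.assoc mult_1_right add.commute)
      qed
      finally show "(\<integral>\<^sup>+t. ennreal (2 powr p) * (J1 t + J0 t) \<partial>M) \<le> ennreal C * (1 + (\<integral>\<^sup>+s. g s powr p \<partial>M))" .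
    next
      fix t v :: real assume t: "t \<in> {0..T}" and v: "0 \<le> v" "ennreal v \<le> sing_pot T (1 - \<beta>) (\<lambda>s. L s * g s + L0 s) t"
      let ?A = "sing_pot T (1 - \<beta>) (\<lambda>s. L s * g s) t" and ?B = "sing_pot T (1 - \<beta>) L0 t"
      \<comment> \<open>If \<open>v\<close> is below a sum of two terms, then its half is below one
        of them; this costs the factor 2 powr p.\<close>
      have "ennreal (v / 2) \<le> ?A \<or> ennreal (v / 2) \<le> ?B"
      proof (rule ccontr)
        assume "\<not> (ennreal (v / 2) \<le> ?A \<or> ennreal (v / 2) \<le> ?B)"
        then have "?A + ?B < ennreal (v / 2) + ennreal (v / 2)"
          by (intro add_strict_mono) auto
        also have "\<dots> = ennreal v" using v(1) by (simp flip: ennreal_plus)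
        finally show False using v(2) split[of t] by simp
      qed
      then have "ennreal ((v / 2) powr p) \<le> J1 t + J0 t"
        using J1v[OF t, of "v / 2"] J0v[OF t, of "v / 2"] v(1)
        by (auto intro: add_increasing add_increasing2)
      then have "ennreal (2 powr p) * ennreal ((v / 2) powr p) \<le> ennreal (2 powr p) * (J1 t + J0 t)"
        by (rule mult_left_mono) simp
      moreover have "2 powr p * (v / 2) powr p = v powr p"
        using v(1) by (simp add: powr_divide)
      ultimately show "ennreal (v powr p) \<le> ennreal (2 powr p) * (J1 t + J0 t)"
        by (simp flip: ennreal_mult)
    qed measurable
  qed
qed

lemma norm_plus_dist_measurable:
  assumes "y \<in> Lp T p" "u \<in> controls T p u0"
  shows "(\<lambda>s. norm (y s) + dist (u s) u0) \<in> borel_measurable M"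
  using Lp_measurable[OF assms(1)] Lp_measurable[OF controlsD(2)[OF assms(2)]] by measurable

lemma norm_plus_dist_nn_integral:
  assumes "y \<in> Lp T p" "u \<in> controls T p u0"
  shows "(\<integral>\<^sup>+s. (norm (y s) + dist (u s) u0) powr p \<partial>M)
    \<le> ennreal (2 powr p) * ((\<integral>\<^sup>+s. norm (y s) powr p \<partial>M) + (\<integral>\<^sup>+s. dist (u s) u0 powr p \<partial>M))"
  using Lp_measurable[OF assms(1)] Lp_measurable[OF controlsD(2)[OF assms(2)]]
  by (intro nn_integral_powr_add_le) auto

lemma norm_plus_dist_nn_integral_finite:
  assumes "y \<in> Lp T p" "u \<in> controls T p u0"
  shows "(\<integral>\<^sup>+s. (norm (y s) + dist (u s) u0) powr p \<partial>M) < \<infinity>"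
  using norm_plus_dist_nn_integral[OF assms] Lp_nn_integral(2)[OF assms(1)]
    Lp_nn_integral(2)[OF controlsD(2)[OF assms(2)]]
  by (auto elim!: order.strict_trans1 simp: ennreal_mult_less_top)

text \<open>The potential dominating the integrand has an integrable majorant of its p-th power, so
  it is finite almost everywhere. This provides the integrability clause of
  \<open>solves\<close>.\<close>

lemma AE_set_integrable:
  assumes y: "y \<in> Lp T p" and u: "u \<in> controls T p u0"
  shows "AE t in M. set_integrable lebesgue {0..<t} (\<lambda>s. f t s (y s) (u s))"
proof -
  let ?g = "\<lambda>s. norm (y s) + dist (u s) u0"
  obtain C where C: "source_bounded C" using ex_source_bounded ..
  obtain J where J: "J \<in> borel_measurable M" "(\<integral>\<^sup>+t. J t \<partial>M) \<le> ennreal C * (1 + (\<integral>\<^sup>+s. ?g s powr p \<partial>M))"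
    "\<And>t v. t\<in>{0..T} \<Longrightarrow> v\<ge>0 \<Longrightarrow> ennreal v \<le> sing_pot T (1 - \<beta>) (\<lambda>s. L s * ?g s + L0 s) t \<Longrightarrow> ennreal (v powr p) \<le> J t"
    using source_boundedD[OF C norm_plus_dist_measurable[OF y u] add_nonneg_nonneg[OF norm_ge_zero zero_le_dist]] by blast
  have "(\<integral>\<^sup>+t. J t \<partial>M) < \<infinity>"
    using J(2) norm_plus_dist_nn_integral_finite[OF y u]
    by (auto elim!: order.strict_trans1 simp: ennreal_mult_less_top)
  from AE_sing_pot_finite[OF J(1) this J(3)]
  have "AE t in M. sing_pot T (1 - \<beta>) (\<lambda>s. L s * ?g s + L0 s) t < \<infinity>" .
  with AE_M_Icc f_section_measurable[OF Lp_measurable[OF y] controlsD(1)[OF u]]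
  show ?thesis
  proof eventually_elim
    case (elim t)
    have "(\<integral>\<^sup>+s. norm (indicator {0..<t} s *\<^sub>R f t s (y s) (u s)) \<partial>lebesgue) < \<infinity>"
      using f_nn_integral_le[OF elim(1)] elim(3) by (rule order.strict_trans1)
    with elim(2) show ?case unfolding set_integrable_def by (rule integrableI_bounded)
  qed
qed

text \<open>\<open>H\<close> specialises to the first component, its norm, and the norm of the
  difference, which covers \<open>V\<close>, \<open>NV\<close> and \<open>DV\<close> at once. The
  integral is measurable for the Borel versions and agrees with theirs for almost every
  \<open>t\<close>; completeness does the rest.\<close>

lemma section_integral_measurable:
  fixes H :: "(real ^ 'n) \<times> (real ^ 'n) \<Rightarrow> 'b::euclidean_space"
  assumes y: "y \<in> Lp T p" and u: "u \<in> controls T p u0" and v: "v \<in> controls T p u0"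
    and H: "H \<in> borel_measurable borel"
  shows "(\<lambda>t. \<integral>s. H (indicator {0..<t} s *\<^sub>R f t s (y s) (u s), indicator {0..<t} s *\<^sub>R f t s (y s) (v s)) \<partial>lebesgue)
    \<in> borel_measurable M"
proof -
  obtain \<phi> where \<phi>: "\<phi> \<in> borel_measurable borel"
    "AE t in M. AE s in lborel. indicator {0..<t} s *\<^sub>R f t s (y s) (u s) = \<phi> (t, s)"
    using f_borel_version[OF Lp_measurable[OF y] controlsD(1)[OF u]] .
  obtain \<psi> where \<psi>: "\<psi> \<in> borel_measurable borel"
    "AE t in M. AE s in lborel. indicator {0..<t} s *\<^sub>R f t s (y s) (v s) = \<psi> (t, s)"
    using f_borel_version[OF Lp_measurable[OF y] controlsD(1)[OF v]] .
  have [measurable]: "\<phi> \<in> borel_measurable (borel \<Otimes>\<^sub>M borel)" "\<psi> \<in> borel_measurable (borel \<Otimes>\<^sub>M borel)"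
    using \<phi>(1) \<psi>(1) by (simp_all add: borel_prod)
  have [measurable]: "H \<in> borel_measurable (borel \<Otimes>\<^sub>M borel)" using H by (simp add: borel_prod)
  have "(\<lambda>t. \<integral>s. H (\<phi> (t, s), \<psi> (t, s)) \<partial>lborel) \<in> borel_measurable lborel"
    by (intro lborel.borel_measurable_lebesgue_integral) measurable
  then have m: "(\<lambda>t. \<integral>s. H (\<phi> (t, s), \<psi> (t, s)) \<partial>lborel) \<in> borel_measurable M"
    by (intro measurable_restrict_space1 measurable_completion)
  show ?thesis
  proof (rule complete_measure.borel_measurable_AE_cong[OF complete_M m])
    show "AE t in M. (\<integral>s. H (indicator {0..<t} s *\<^sub>R f t s (y s) (u s), indicator {0..<t} s *\<^sub>R f t s (y s) (v s)) \<partial>lebesgue)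
        = (\<integral>s. H (\<phi> (t, s), \<psi> (t, s)) \<partial>lborel)"
      using \<phi>(2) \<psi>(2)
    proof eventually_elim
      case (elim t)
      have m2: "(\<lambda>s. H (\<phi> (t, s), \<psi> (t, s))) \<in> borel_measurable lborel" by measurable
      have ae: "AE s in lebesgue. H (indicator {0..<t} s *\<^sub>R f t s (y s) (u s), indicator {0..<t} s *\<^sub>R f t s (y s) (v s))
          = H (\<phi> (t, s), \<psi> (t, s))"
      proof (rule AE_completion)
        show "AE s in lborel. H (indicator {0..<t} s *\<^sub>R f t s (y s) (u s), indicator {0..<t} s *\<^sub>R f t s (y s) (v s))
          = H (\<phi> (t, s), \<psi> (t, s))"
          using elim by eventually_elim simp
      qed
      have "(\<integral>s. H (indicator {0..<t} s *\<^sub>R f t s (y s) (u s), indicator {0..<t} s *\<^sub>R f t s (y s) (v s)) \<partial>lebesgue)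
          = (\<integral>s. H (\<phi> (t, s), \<psi> (t, s)) \<partial>lebesgue)"
        using ae m2 by (intro integral_cong_AE completion.borel_measurable_AE_cong[OF _ ae] measurable_completion)
      also have "\<dots> = (\<integral>s. H (\<phi> (t, s), \<psi> (t, s)) \<partial>lborel)"
        using m2 by (rule integral_completion)
      finally show ?case .
    qed
  qed
qed

lemma V_measurable:
  assumes "y \<in> Lp T p" "u \<in> controls T p u0"
  shows "V y u \<in> borel_measurable M"
proof -
  have "V y u = (\<lambda>t. \<integral>s. fst (indicator {0..<t} s *\<^sub>R f t s (y s) (u s), indicator {0..<t} s *\<^sub>R f t s (y s) (u s)) \<partial>lebesgue)"
    by (simp add: V_def set_lebesgue_integral_def fun_eq_iff)
  then show ?thesis
    using section_integral_measurable[OF assms assms(2), of fst] by (simp add: borel_prod[symmetric])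
qed

lemma NV_measurable:
  assumes "y \<in> Lp T p" "u \<in> controls T p u0"
  shows "NV y u \<in> borel_measurable M"
proof -
  have "indicator {0..<t} s *\<^sub>R norm (f t s (y s) (u s))
      = norm (fst (indicator {0..<t} s *\<^sub>R f t s (y s) (u s), indicator {0..<t} s *\<^sub>R f t s (y s) (u s)))" for t s
    by (simp add: indicator_def)
  then show ?thesis
    using section_integral_measurable[OF assms assms(2), of "\<lambda>x. norm (fst x)"]
    unfolding NV_def[abs_def] set_lebesgue_integral_def by (simp add: borel_prod[symmetric])
qed

lemma DV_measurable:
  assumes "y \<in> Lp T p" "u \<in> controls T p u0" "v \<in> controls T p u0"
  shows "DV y u v \<in> borel_measurable M"
proof -
  have "indicator {0..<t} s *\<^sub>R norm (f t s (y s) (u s) - f t s (y s) (v s))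
      = (\<lambda>x. norm (fst x - snd x)) (indicator {0..<t} s *\<^sub>R f t s (y s) (u s), indicator {0..<t} s *\<^sub>R f t s (y s) (v s))" for t s
    by (simp add: indicator_def)
  then show ?thesis
    using section_integral_measurable[OF assms, of "\<lambda>x. norm (fst x - snd x)"]
    unfolding DV_def[abs_def] set_lebesgue_integral_def by (simp add: borel_prod[symmetric])
qed

text \<open>Integrability identifies the Bochner integral \<open>NV\<close> with a nonnegative
  integral, which can be compared with the potential.\<close>

lemma AE_NV_le:
  assumes y: "y \<in> Lp T p" and u: "u \<in> controls T p u0"
  shows "AE t in M. norm (V y u t) \<le> NV y u t \<and>
     ennreal (NV y u t) \<le> sing_pot T (1 - \<beta>) (\<lambda>s. L s * (norm (y s) + dist (u s) u0) + L0 s) t"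
  using AE_set_integrable[OF y u] AE_M_Icc
proof eventually_elim
  case (elim t)
  note int = elim(1)[unfolded set_integrable_def]
  have eq: "indicator {0..<t} s *\<^sub>R norm (f t s (y s) (u s)) = norm (indicator {0..<t} s *\<^sub>R f t s (y s) (u s))" for s
    by (auto simp: indicator_def)
  have "ennreal (NV y u t) = (\<integral>\<^sup>+s. norm (indicator {0..<t} s *\<^sub>R f t s (y s) (u s)) \<partial>lebesgue)"
    unfolding NV_def set_lebesgue_integral_def eq
    by (intro nn_integral_eq_integral[symmetric] integrable_norm int) auto
  moreover have "norm (V y u t) \<le> NV y u t"
    unfolding V_def NV_def set_lebesgue_integral_def eq by (rule integral_norm_bound)
  ultimately show ?case using f_nn_integral_le[OF elim(2), of y u] by simp
qed

lemma NV_nonneg: "0 \<le> NV y u t" and DV_nonneg: "0 \<le> DV y u v t"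
  unfolding NV_def DV_def set_lebesgue_integral_def by (auto intro!: integral_nonneg_AE)

definition NV_bounded :: "real \<Rightarrow> bool" where
  "NV_bounded C \<longleftrightarrow> 0 < C \<and> (\<forall>y\<in>Lp T p. \<forall>u\<in>controls T p u0.
    (\<integral>\<^sup>+t. NV y u t powr p \<partial>M) \<le> ennreal C * (1 + (\<integral>\<^sup>+s. (norm (y s) + dist (u s) u0) powr p \<partial>M)))"

lemmas NV_bounded_pos = NV_bounded_def[THEN iffD1, THEN conjunct1]
lemmas NV_bounded_le = NV_bounded_def[THEN iffD1, THEN conjunct2, rule_format]

lemma ex_NV_bounded: "\<exists>C. NV_bounded C"
proof -
  obtain C where C: "source_bounded C" using ex_source_bounded ..
  show ?thesis
    unfolding NV_bounded_def
  proof (intro exI[of _ C] conjI ballI)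
    show "0 < C" using C by (simp add: source_bounded_def)
    fix y :: "real \<Rightarrow> real ^ 'n" and u :: "real \<Rightarrow> 'u" assume yu: "y \<in> Lp T p" "u \<in> controls T p u0"
    let ?g = "\<lambda>s. norm (y s) + dist (u s) u0"
    obtain J where J: "J \<in> borel_measurable M" "(\<integral>\<^sup>+t. J t \<partial>M) \<le> ennreal C * (1 + (\<integral>\<^sup>+s. ?g s powr p \<partial>M))"
      "\<And>t v. t\<in>{0..T} \<Longrightarrow> v\<ge>0 \<Longrightarrow> ennreal v \<le> sing_pot T (1 - \<beta>) (\<lambda>s. L s * ?g s + L0 s) t \<Longrightarrow> ennreal (v powr p) \<le> J t"
      using source_boundedD[OF C norm_plus_dist_measurable[OF yu] add_nonneg_nonneg[OF norm_ge_zero zero_le_dist]] by blast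
    have "(\<integral>\<^sup>+t. NV y u t powr p \<partial>M) \<le> (\<integral>\<^sup>+t. J t \<partial>M)"
    proof (rule nn_integral_mono_AE)
      show "AE t in M. ennreal (NV y u t powr p) \<le> J t"
        using AE_NV_le[OF yu] AE_M_Icc by eventually_elim (blast intro: J(3) NV_nonneg)
    qed
    with J(2) show "(\<integral>\<^sup>+t. NV y u t powr p \<partial>M) \<le> ennreal C * (1 + (\<integral>\<^sup>+s. ?g s powr p \<partial>M))" by simp
  qed
qed

lemma NV_nn_integral_finite:
  assumes yu: "y \<in> Lp T p" "u \<in> controls T p u0"
  shows "(\<integral>\<^sup>+t. NV y u t powr p \<partial>M) < \<infinity>"
proof -
  obtain C where C: "NV_bounded C" using ex_NV_bounded ..
  note NV_bounded_le[OF C yu]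
  also have "ennreal C * (1 + (\<integral>\<^sup>+s. (norm (y s) + dist (u s) u0) powr p \<partial>M)) < \<infinity>"
    using norm_plus_dist_nn_integral_finite[OF yu] by (simp add: ennreal_mult_less_top)
  finally show ?thesis .
qed

lemma nn_integral_norm_V_le:
  assumes "y \<in> Lp T p" "u \<in> controls T p u0"
  shows "(\<integral>\<^sup>+t. norm (V y u t) powr p \<partial>M) \<le> (\<integral>\<^sup>+t. NV y u t powr p \<partial>M)"
  using AE_NV_le[OF assms] p
  by (intro nn_integral_mono_AE) (auto elim!: eventually_mono intro!: ennreal_leI powr_mono2)

lemma V_Lp:
  assumes "y \<in> Lp T p" "u \<in> controls T p u0"
  shows "V y u \<in> Lp T p"
  using V_measurable[OF assms] nn_integral_norm_V_le[OF assms] NV_nn_integral_finite[OF assms]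
  by (intro LpI) auto

lemma Lp_add:
  fixes g h :: "real \<Rightarrow> 'b::euclidean_space"
  assumes g: "g \<in> Lp T p" and h: "h \<in> Lp T p"
  shows "(\<lambda>t. g t + h t) \<in> Lp T p"
proof (rule LpI)
  note [measurable] = Lp_measurable[OF g] Lp_measurable[OF h]
  show "(\<lambda>t. g t + h t) \<in> borel_measurable M" by measurable
  have "(\<integral>\<^sup>+t. norm (g t + h t) powr p \<partial>M) \<le> (\<integral>\<^sup>+t. (norm (g t) + norm (h t)) powr p \<partial>M)"
    using p by (intro nn_integral_mono ennreal_leI powr_mono2 norm_triangle_ineq) auto
  also have "\<dots> \<le> ennreal (2 powr p) * ((\<integral>\<^sup>+s. norm (g s) powr p \<partial>M) + (\<integral>\<^sup>+s. norm (h s) powr p \<partial>M))"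
    by (intro nn_integral_powr_add_le) auto
  also have "\<dots> < \<infinity>"
    using Lp_nn_integral(2)[OF g] Lp_nn_integral(2)[OF h] by (simp add: ennreal_mult_less_top)
  finally show "(\<integral>\<^sup>+t. norm (g t + h t) powr p \<partial>M) < \<infinity>" .
qed

lemma Lp_diff:
  fixes g h :: "real \<Rightarrow> 'b::euclidean_space"
  assumes g: "g \<in> Lp T p" and h: "h \<in> Lp T p"
  shows "(\<lambda>t. g t - h t) \<in> Lp T p"
proof -
  have "(\<lambda>t. - h t) \<in> Lp T p" using h by (simp add: Lp_def)
  from Lp_add[OF g this] show ?thesis by simp
qed

text \<open>Both integrals must exist before they can be merged into the integral of the difference;
  this restricts the estimate to almost every \<open>t\<close>.\<close>

lemma AE_V_lipschitz:
  assumes y: "y \<in> Lp T p" and z: "z \<in> Lp T p" and u: "u \<in> controls T p u0"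
  shows "AE t in M. ennreal (norm (V y u t - V z u t)) \<le> sing_pot T (1 - \<beta>) (\<lambda>s. L s * norm (y s - z s)) t"
  using AE_set_integrable[OF y u] AE_set_integrable[OF z u] AE_M_Icc
proof eventually_elim
  case (elim t)
  have int: "set_integrable lebesgue {0..<t} (\<lambda>s. f t s (y s) (u s) - f t s (z s) (u s))"
    by (intro set_integral_diff elim)
  have "V y u t - V z u t = (LINT s:{0..<t}|lebesgue. f t s (y s) (u s) - f t s (z s) (u s))"
    unfolding V_def by (intro set_integral_diff(2)[symmetric] elim)
  then have "ennreal (norm (V y u t - V z u t))
      \<le> (\<integral>\<^sup>+s. norm (indicator {0..<t} s *\<^sub>R (f t s (y s) (u s) - f t s (z s) (u s))) \<partial>lebesgue)"
    using integral_norm_bound_ennreal[OF int[unfolded set_integrable_def]] by (simp add: set_lebesgue_integral_def)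
  also have "\<dots> \<le> sing_pot T (1 - \<beta>) (\<lambda>s. L s * norm (y s - z s)) t"
    using elim(3) by (intro nn_integral_le_sing_pot f_lip) (auto simp: Delta_def)
  finally show ?case .
qed

lemma AE_DV:
  assumes y: "y \<in> Lp T p" and u: "u \<in> controls T p u0" and v: "v \<in> controls T p u0"
  shows "AE t in M. norm (V y u t - V y v t) \<le> DV y u v t \<and> DV y u v t \<le> NV y u t + NV y v t"
  using AE_set_integrable[OF y u] AE_set_integrable[OF y v]
proof eventually_elim
  case (elim t)
  have int: "set_integrable lebesgue {0..<t} (\<lambda>s. f t s (y s) (u s) - f t s (y s) (v s))"
    by (intro set_integral_diff elim)
  have "V y u t - V y v t = (LINT s:{0..<t}|lebesgue. f t s (y s) (u s) - f t s (y s) (v s))"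
    unfolding V_def by (intro set_integral_diff(2)[symmetric] elim)
  moreover have "norm \<dots> \<le> DV y u v t"
  proof -
    have eq: "indicator {0..<t} s *\<^sub>R norm (f t s (y s) (u s) - f t s (y s) (v s))
       = norm (indicator {0..<t} s *\<^sub>R (f t s (y s) (u s) - f t s (y s) (v s)))" for s
      by (auto simp: indicator_def)
    show ?thesis unfolding DV_def set_lebesgue_integral_def eq by (rule integral_norm_bound)
  qed
  moreover have "DV y u v t \<le> (LINT s:{0..<t}|lebesgue. norm (f t s (y s) (u s)) + norm (f t s (y s) (v s)))"
    unfolding DV_def
    by (intro set_integral_mono set_integrable_norm set_integral_add int elim norm_triangle_ineq4)
  moreover have "\<dots> = NV y u t + NV y v t"
    unfolding NV_def by (intro set_integral_add set_integrable_norm elim)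
  ultimately show ?case by simp
qed

lemma DV_Lp:
  assumes y: "y \<in> Lp T p" and u: "u \<in> controls T p u0" and v: "v \<in> controls T p u0"
  shows "DV y u v \<in> Lp T p"
proof (rule LpI[OF DV_measurable[OF assms]])
  have "(\<integral>\<^sup>+t. norm (DV y u v t) powr p \<partial>M)
      \<le> (\<integral>\<^sup>+t. ennreal (2 powr p) * (ennreal (NV y u t powr p) + ennreal (NV y v t powr p)) \<partial>M)"
    using AE_DV[OF assms]
  proof (intro nn_integral_mono_AE, eventually_elim)
    case (elim t)
    have "norm (DV y u v t) powr p \<le> (NV y u t + NV y v t) powr p"
      using elim p DV_nonneg[of y u v t] by (intro powr_mono2) auto
    also have "\<dots> \<le> 2 powr p * (NV y u t powr p + NV y v t powr p)"
      by (intro powr_add_le NV_nonneg)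
    finally show ?case by (simp flip: ennreal_plus ennreal_mult add: ennreal_leI)
  qed
  also have "\<dots> < \<infinity>"
    using NV_nn_integral_finite[OF y u] NV_nn_integral_finite[OF y v] NV_measurable[OF y u] NV_measurable[OF y v]
    by (simp add: nn_integral_cmult nn_integral_add ennreal_mult_less_top)
  finally show "(\<integral>\<^sup>+t. norm (DV y u v t) powr p \<partial>M) < \<infinity>" .
qed

section \<open>A Gronwall inequality for the singular kernel\<close>

lemma exp_measurable: "(\<lambda>s. exp (- l * s)) \<in> borel_measurable M"
  by (intro measurable_restrict_space1 measurable_completion) simp

lemma weighted_nn_integral_le:
  assumes l: "l > 0" and h: "\<And>t. 0 \<le> h t"
  shows "(\<integral>\<^sup>+t. (exp (- l * t) * h t) powr p \<partial>M) \<le> (\<integral>\<^sup>+t. h t powr p \<partial>M)"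
proof (rule nn_integral_mono)
  fix t assume "t \<in> space M"
  then have "exp (- l * t) \<le> 1" using l by simp
  then have "exp (- l * t) * h t \<le> 1 * h t" using h by (intro mult_right_mono)
  then show "ennreal ((exp (- l * t) * h t) powr p) \<le> ennreal (h t powr p)"
    using h p by (intro ennreal_leI powr_mono2) auto
qed

text \<open>On [0, T] the weight is at least exp (- l * T), which fixes the price for leaving the
  weighted norm.\<close>

lemma nn_integral_le_weighted:
  assumes l: "l > 0" and [measurable]: "w \<in> borel_measurable M" and w: "\<And>t. 0 \<le> w t"
  shows "(\<integral>\<^sup>+t. w t powr p \<partial>M) \<le> ennreal (exp (l * T) powr p) * (\<integral>\<^sup>+t. (exp (- l * t) * w t) powr p \<partial>M)"
proof -
  note [measurable] = exp_measurable[of l]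
  have "(\<integral>\<^sup>+t. w t powr p \<partial>M) \<le> (\<integral>\<^sup>+t. ennreal (exp (l * T) powr p) * ennreal ((exp (- l * t) * w t) powr p) \<partial>M)"
  proof (rule nn_integral_mono)
    fix t assume "t \<in> space M"
    then have "exp (l * t) \<le> exp (l * T)" using l by simp
    then have "exp (l * t) * (exp (- l * t) * w t) \<le> exp (l * T) * (exp (- l * t) * w t)"
      using w by (intro mult_right_mono) auto
    then have "w t \<le> exp (l * T) * (exp (- l * t) * w t)" by (simp add: mult.assoc[symmetric] flip: exp_add)
    then have "w t powr p \<le> (exp (l * T) * (exp (- l * t) * w t)) powr p"
      using w p by (intro powr_mono2) auto
    also have "\<dots> = exp (l * T) powr p * (exp (- l * t) * w t) powr p" using w by (simp add: powr_mult)
    finally show "ennreal (w t powr p) \<le> ennreal (exp (l * T) powr p) * ennreal ((exp (- l * t) * w t) powr p)"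
      by (simp add: ennreal_leI flip: ennreal_mult)
  qed
  also have "\<dots> = ennreal (exp (l * T) powr p) * (\<integral>\<^sup>+t. (exp (- l * t) * w t) powr p \<partial>M)"
    by (rule nn_integral_cmult) measurable
  finally show ?thesis .
qed

definition Gronwall_const :: "real \<Rightarrow> bool" where
  "Gronwall_const C \<longleftrightarrow> 0 < C \<and> (\<forall>w h. w \<in> borel_measurable M \<longrightarrow> h \<in> borel_measurable M \<longrightarrow>
    (\<forall>t. 0 \<le> w t) \<longrightarrow> (\<forall>t. 0 \<le> h t) \<longrightarrow> (\<integral>\<^sup>+t. w t powr p \<partial>M) < \<infinity> \<longrightarrow>
    (AE t in M. ennreal (w t) \<le> ennreal (h t) + sing_pot T (1 - \<beta>) (\<lambda>s. L s * w s) t) \<longrightarrow>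
    (\<integral>\<^sup>+t. w t powr p \<partial>M) \<le> ennreal C * (\<integral>\<^sup>+t. h t powr p \<partial>M))"

lemmas Gronwall_const_pos = Gronwall_const_def[THEN iffD1, THEN conjunct1]
lemmas Gronwall_const_le = Gronwall_const_def[THEN iffD1, THEN conjunct2, rule_format]

lemma singular_Gronwall: "\<exists>C. Gronwall_const C"
proof -
  \<comment> \<open>After the factor 2 powr p of \<open>nn_integral_powr_add_le\<close> the
    contraction term keeps the coefficient 1 / 2.\<close>
  define e where "e = 1 / (2 * 2 powr p)"
  have e: "e > 0" "2 powr p * e = 1 / 2" by (auto simp: e_def)
  obtain l where "contraction_rate e l" using ex_contraction_rate[OF e(1)] ..
  note l = contraction_rate_pos[OF this] and contr = contraction_rate_le[OF this]
  note [measurable] = exp_measurable[of l]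
  show ?thesis
    unfolding Gronwall_const_def
  \<comment> \<open>2 * 2 powr p results from absorbing one half of the left side, the exponential
    from removing the weight.\<close>
  proof (intro exI[of _ "exp (l * T) powr p * (2 * 2 powr p)"] conjI allI impI)
    fix w h :: "real \<Rightarrow> real"
    assume [measurable]: "w \<in> borel_measurable M" "h \<in> borel_measurable M"
      and w': "\<forall>t. 0 \<le> w t" and h': "\<forall>t. 0 \<le> h t" and fin: "(\<integral>\<^sup>+t. w t powr p \<partial>M) < \<infinity>"
      and le: "AE t in M. ennreal (w t) \<le> ennreal (h t) + sing_pot T (1 - \<beta>) (\<lambda>s. L s * w s) t"
    have w: "\<And>t. 0 \<le> w t" and h: "\<And>t. 0 \<le> h t" using w' h' by auto
    \<comment> \<open>The excess of \<open>w\<close> over \<open>h\<close> is what the potential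
      dominates; truncation at 0 keeps w \<le> h + v at every point.\<close>
    define v where "v = (\<lambda>t. max 0 (w t - h t))"
    have v: "0 \<le> v t" for t by (simp add: v_def)
    have [measurable]: "v \<in> borel_measurable M" unfolding v_def by measurable
    have vle: "AE t in M. ennreal (v t) \<le> sing_pot T (1 - \<beta>) (\<lambda>s. L s * w s) t"
      using le
    proof eventually_elim
      case (elim t)
      show ?case
      proof (cases "sing_pot T (1 - \<beta>) (\<lambda>s. L s * w s) t")
        case (real r)
        then have "w t \<le> h t + r" using elim h[of t] by (simp flip: ennreal_plus)
        then show ?thesis using real by (auto simp: v_def intro!: ennreal_leI)
      qed auto
    qed
    define E where "E g = (\<integral>\<^sup>+t. (exp (- l * t) * g t) powr p \<partial>M)" for g :: "real \<Rightarrow> real"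
    have "E w \<le> (\<integral>\<^sup>+t. (exp (- l * t) * h t + exp (- l * t) * v t) powr p \<partial>M)"
      unfolding E_def
    proof (intro nn_integral_mono ennreal_leI powr_mono2)
      fix t
      have "exp (- l * t) * w t \<le> exp (- l * t) * (h t + v t)"
        by (intro mult_left_mono) (auto simp: v_def)
      then show "exp (- l * t) * w t \<le> exp (- l * t) * h t + exp (- l * t) * v t" by (simp only: distrib_left)
    qed (use p w in auto)
    also have "\<dots> \<le> ennreal (2 powr p) * (E h + E v)"
      unfolding E_def
    proof (rule nn_integral_powr_add_le)
      show "(\<lambda>t. exp (- l * t) * h t) \<in> borel_measurable M" "(\<lambda>t. exp (- l * t) * v t) \<in> borel_measurable M"
        by measurable
    qed (use h v in auto)
    also have "\<dots> \<le> ennreal (2 powr p) * (E h + ennreal e * E w)"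
      unfolding E_def using w v vle by (intro mult_left_mono add_left_mono contr) auto
    also have "\<dots> = ennreal (2 powr p) * E h + ennreal (2 powr p * e) * E w"
      using e(1) by (simp only: distrib_left mult.assoc[symmetric]) (simp add: ennreal_mult)
    finally have 1: "E w \<le> ennreal (2 powr p) * E h + ennreal (1 / 2) * E w" by (simp only: e(2))
    \<comment> \<open>Finiteness of \<open>E w\<close> is what permits subtracting half of it from
      both sides.\<close>
    have "E w < \<infinity>" using weighted_nn_integral_le[OF l w] fin unfolding E_def by (rule order.strict_trans1)
    then obtain x where x: "E w = ennreal x" "0 \<le> x" by (cases "E w") auto
    have 2: "E w \<le> ennreal (2 * 2 powr p) * E h"
    proof (cases "E h")
      case (real y)
      have "ennreal (2 powr p) * ennreal y + ennreal (1 / 2) * ennreal x = ennreal (2 powr p * y) + ennreal (1 / 2 * x)"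
        using real(1) x(2) by (intro arg_cong2[of _ _ _ _ "(+)"] ennreal_mult[symmetric]) auto
      also have "\<dots> = ennreal (2 powr p * y + 1 / 2 * x)"
        using real(1) x(2) by (intro ennreal_plus[symmetric]) auto
      finally have eq: "ennreal (2 powr p) * ennreal y + ennreal (1 / 2) * ennreal x = ennreal (2 powr p * y + 1 / 2 * x)" .
      have "ennreal x \<le> ennreal (2 powr p * y + 1 / 2 * x)"
        using 1[unfolded x(1) real(2)] unfolding eq .
      moreover have "0 \<le> 2 powr p * y + 1 / 2 * x" using real(1) x(2) by simp
      ultimately have "x \<le> 2 powr p * y + 1 / 2 * x" by (simp only: ennreal_le_iff)
      then have "x \<le> 2 * 2 powr p * y" by simp
      then show ?thesis using real x by (simp add: ennreal_leI flip: ennreal_mult)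
    qed (simp add: ennreal_mult_top)
    have "(\<integral>\<^sup>+t. w t powr p \<partial>M) \<le> ennreal (exp (l * T) powr p) * E w"
      unfolding E_def using l w by (intro nn_integral_le_weighted) auto
    also have "\<dots> \<le> ennreal (exp (l * T) powr p) * (ennreal (2 * 2 powr p) * (\<integral>\<^sup>+t. h t powr p \<partial>M))"
      using order_trans[OF 2[unfolded E_def] mult_left_mono[OF weighted_nn_integral_le[OF l h]]]
      unfolding E_def by (intro mult_left_mono) auto
    also have "\<dots> = ennreal (exp (l * T) powr p * (2 * 2 powr p)) * (\<integral>\<^sup>+t. h t powr p \<partial>M)"
      by (subst ennreal_mult[of "exp (l * T) powr p"]) (auto simp: mult.assoc)
    finally show "(\<integral>\<^sup>+t. w t powr p \<partial>M) \<le> ennreal (exp (l * T) powr p * (2 * 2 powr p)) * (\<integral>\<^sup>+t. h t powr p \<partial>M)" .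
  qed simp
qed

section \<open>Existence by Picard iteration\<close>

lemma solves_iff:
  "solves T f \<eta> u y \<longleftrightarrow>
    (AE t in M. set_integrable lebesgue {0..<t} (\<lambda>s. f t s (y s) (u s)) \<and> y t = \<eta> t + V y u t)"
  by (simp add: solves_def V_def)

lemma Lp_dominated:
  fixes g :: "real \<Rightarrow> 'b::euclidean_space" and h :: "real \<Rightarrow> real"
  assumes "g \<in> borel_measurable M" "h \<in> Lp T p" "AE t in M. norm (g t) \<le> h t"
  shows "g \<in> Lp T p"
proof (rule LpI[OF assms(1)])
  have "(\<integral>\<^sup>+t. norm (g t) powr p \<partial>M) \<le> (\<integral>\<^sup>+t. norm (h t) powr p \<partial>M)"
    using assms(3) p by (intro nn_integral_mono_AE) (auto elim!: eventually_mono intro!: ennreal_leI powr_mono2)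
  also have "\<dots> < \<infinity>" by (rule Lp_nn_integral(2)[OF assms(2)])
  finally show "(\<integral>\<^sup>+t. norm (g t) powr p \<partial>M) < \<infinity>" .
qed

lemma Lp_norm_powr:
  assumes "g \<in> Lp T p"
  shows "(\<integral>\<^sup>+t. norm (g t) powr p \<partial>M) = ennreal (Lp_norm T p g powr p)"
proof -
  have "Lp_norm T p g powr p = (LINT t|M. norm (g t) powr p)"
    using p by (simp add: Lp_norm_def powr_powr)
  moreover have "(\<integral>\<^sup>+t. norm (g t) powr p \<partial>M) = ennreal (LINT t|M. norm (g t) powr p)"
    using assms by (intro nn_integral_eq_integral) (auto simp: Lp_def)
  ultimately show ?thesis by simp
qed

lemma Lp_norm_nonneg: "0 \<le> Lp_norm T p g"
  by (simp add: Lp_norm_def)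

lemma Lp_norm_fun: "g \<in> Lp T p \<Longrightarrow> (\<lambda>t. norm (g t)) \<in> Lp T p"
  by (auto simp: Lp_def intro: borel_measurable_norm)

text \<open>Applied to the Picard majorant: a finite potential times (1 / 2) ^ n tends to 0, which
  replaces dominated convergence in the limit of the integral terms.\<close>

lemma AE_pot_Lp_finite:
  assumes W: "W \<in> Lp T p" and W0: "\<And>t. 0 \<le> W t"
  shows "AE t in M. sing_pot T (1 - \<beta>) (\<lambda>s. L s * W s) t < \<infinity>"
proof -
  obtain C where C: "pot_bounded (1 - \<beta>) C" using ex_pot_bounded by blast
  obtain J where J: "J \<in> borel_measurable M" "(\<integral>\<^sup>+t. J t \<partial>M) \<le> ennreal C * (\<integral>\<^sup>+s. W s powr p \<partial>M)"
    "\<And>t v. t \<in> {0..T} \<Longrightarrow> v \<ge> 0 \<Longrightarrow> ennreal v \<le> sing_pot T (1 - \<beta>) (\<lambda>s. L s * W s) t \<Longrightarrow> ennreal (v powr p) \<le> J t"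
    using pot_boundedD[OF C Lp_measurable[OF W] W0] by blast
  have "(\<integral>\<^sup>+s. W s powr p \<partial>M) < \<infinity>" using Lp_nn_integral(2)[OF W] W0 by simp
  then have "ennreal C * (\<integral>\<^sup>+s. W s powr p \<partial>M) < \<infinity>" by (simp add: ennreal_mult_less_top)
  with J(2) have "(\<integral>\<^sup>+t. J t \<partial>M) < \<infinity>" by (rule order.strict_trans1)
  from AE_sing_pot_finite[OF J(1) this J(3)] show ?thesis .
qed

text \<open>If the weighted increments decay like \<open>(2 * 2 powr p) ^ (- n)\<close> in the \<open>p\<close>-th power, then multiplying
  them by \<open>2 ^ n\<close> still gives a summable series; its \<open>p\<close>-th root is a common majorant.\<close>
lemma picard_majorant:
  assumes [measurable]: "\<And>n. d n \<in> borel_measurable M" and d0: "\<And>n t. 0 \<le> d n t" and dLp: "d 0 \<in> Lp T p"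
    and step: "\<And>n. AE t in M. ennreal (d (Suc n) t) \<le> sing_pot T (1 - \<beta>) (\<lambda>s. L s * d n s) t"
  obtains W where "W \<in> Lp T p" "\<And>t. 0 \<le> W t" "AE t in M. \<forall>n. d n t \<le> W t * (1 / 2) ^ n"
proof -
  \<comment> \<open>With this \<open>e\<close> the factor (2 ^ n) powr p * e ^ n equals (1 / 2) ^
    n.\<close>
  define e where "e = 1 / (2 * 2 powr p)"
  have e: "e > 0" "2 powr p * e = 1 / 2" by (auto simp: e_def)
  obtain l where "contraction_rate e l" using ex_contraction_rate[OF e(1)] ..
  note l = contraction_rate_pos[OF this] and contr = contraction_rate_le[OF this]
  note [measurable] = exp_measurable[of l]
  define E where "E n = (\<integral>\<^sup>+t. (exp (- l * t) * d n t) powr p \<partial>M)" for n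
  have E: "E n \<le> ennreal (e ^ n) * E 0" for n
  proof (induction n)
    case (Suc n)
    have "E (Suc n) \<le> ennreal e * E n"
      unfolding E_def using d0 step by (intro contr) auto
    also have "\<dots> \<le> ennreal e * (ennreal (e ^ n) * E 0)" by (intro mult_left_mono Suc) auto
    also have "\<dots> = ennreal (e ^ Suc n) * E 0" using e by (simp add: ennreal_mult mult.assoc)
    finally show ?case .
  qed simp
  have "E 0 \<le> (\<integral>\<^sup>+t. d 0 t powr p \<partial>M)" unfolding E_def using l d0 by (intro weighted_nn_integral_le) auto
  also have "\<dots> < \<infinity>" using Lp_nn_integral(2)[OF dLp] d0 by simp
  finally have E0: "E 0 < \<infinity>" .
  define q where "q n t = (2 ^ n * (exp (- l * t) * d n t)) powr p" for n t
  have [measurable]: "q n \<in> borel_measurable M" for n unfolding q_def by measurable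
  define S where "S t = (\<Sum>n. ennreal (q n t))" for t
  have [measurable]: "S \<in> borel_measurable M" unfolding S_def by measurable
  have qE: "(\<integral>\<^sup>+t. q n t \<partial>M) \<le> ennreal ((1 / 2) ^ n) * E 0" for n
  proof -
    have "(\<integral>\<^sup>+t. q n t \<partial>M) = (\<integral>\<^sup>+t. ennreal ((2 powr p) ^ n) * ennreal ((exp (- l * t) * d n t) powr p) \<partial>M)"
    proof (intro nn_integral_cong)
      fix t
      have "((2::real) ^ n) powr p = (2 powr p) ^ n"
        by (simp add: powr_powr powr_realpow[symmetric] mult.commute)
      then have "q n t = (2 powr p) ^ n * (exp (- l * t) * d n t) powr p"
        using d0 unfolding q_def by (subst powr_mult) auto
      then show "ennreal (q n t) = ennreal ((2 powr p) ^ n) * ennreal ((exp (- l * t) * d n t) powr p)"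
        by (simp add: ennreal_mult)
    qed
    also have "\<dots> = ennreal ((2 powr p) ^ n) * E n" unfolding E_def by (rule nn_integral_cmult) measurable
    also have "\<dots> \<le> ennreal ((2 powr p) ^ n) * (ennreal (e ^ n) * E 0)" by (intro mult_left_mono E) auto
    also have "\<dots> = ennreal ((2 powr p) ^ n * e ^ n) * E 0" using e by (simp add: ennreal_mult mult.assoc)
    also have "(2 powr p) ^ n * e ^ n = (1 / 2) ^ n" by (simp only: power_mult_distrib[symmetric] e(2))
    finally show ?thesis .
  qed
  have "(\<integral>\<^sup>+t. S t \<partial>M) = (\<Sum>n. \<integral>\<^sup>+t. q n t \<partial>M)" unfolding S_def by (rule nn_integral_suminf) measurable
  also have "\<dots> \<le> (\<Sum>n. ennreal ((1 / 2) ^ n) * E 0)" by (intro suminf_le qE) auto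
  also have "\<dots> = (\<Sum>n. ennreal ((1 / 2) ^ n)) * E 0" by simp
  also have "(\<Sum>n. ennreal ((1 / 2) ^ n)) = ennreal (1 / (1 - 1 / 2))"
    by (intro suminf_ennreal_eq geometric_sums) auto
  also have "\<dots> * E 0 < \<infinity>" using E0 by (simp add: ennreal_mult_less_top)
  finally have Sfin: "(\<integral>\<^sup>+t. S t \<partial>M) < \<infinity>" .
  then have SAE: "AE t in M. S t \<noteq> \<infinity>" by (intro nn_integral_PInf_AE) auto
  \<comment> \<open>\<open>enn2real\<close> sends an infinite sum to 0, which affects a null set
    only. The factor exp (l * T) undoes the weight for all t \<le> T.\<close>
  define W where "W t = exp (l * T) * enn2real (S t) powr (1 / p)" for t
  show thesis
  proof (rule that[of W])
    show W0: "0 \<le> W t" for t by (simp add: W_def)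
    show "W \<in> Lp T p"
    proof (rule LpI)
      show "W \<in> borel_measurable M" unfolding W_def by measurable
      have "(\<integral>\<^sup>+t. norm (W t) powr p \<partial>M) \<le> (\<integral>\<^sup>+t. ennreal (exp (l * T) powr p) * S t \<partial>M)"
      proof (rule nn_integral_mono)
        fix t
        have "norm (W t) powr p = exp (l * T) powr p * enn2real (S t)"
          using p by (simp add: W_def abs_mult powr_mult powr_powr)
        moreover have "ennreal (enn2real (S t)) \<le> S t" by (cases "S t") auto
        ultimately show "ennreal (norm (W t) powr p) \<le> ennreal (exp (l * T) powr p) * S t"
          by (simp add: ennreal_mult mult_left_mono)
      qed
      also have "\<dots> = ennreal (exp (l * T) powr p) * (\<integral>\<^sup>+t. S t \<partial>M)" by (rule nn_integral_cmult) measurable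
      also have "\<dots> < \<infinity>" using Sfin by (simp add: ennreal_mult_less_top)
      finally show "(\<integral>\<^sup>+t. norm (W t) powr p \<partial>M) < \<infinity>" .
    qed
    show "AE t in M. \<forall>n. d n t \<le> W t * (1 / 2) ^ n"
      using SAE AE_M_Icc
    proof eventually_elim
      case (elim t)
      show ?case
      proof
        fix n
        obtain r where r: "S t = ennreal r" "0 \<le> r" using elim(1) by (cases "S t") auto
        have "ennreal (q n t) = (\<Sum>k\<in>{n}. ennreal (q k t))" by simp
        also have "\<dots> \<le> S t" unfolding S_def by (intro sum_le_suminf) auto
        finally have "q n t \<le> r" using r by simp
        then have "q n t powr (1 / p) \<le> r powr (1 / p)" using p by (intro powr_mono2) (auto simp: q_def)
        moreover have "q n t powr (1 / p) = 2 ^ n * (exp (- l * t) * d n t)"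
          using p d0 by (simp add: q_def powr_powr)
        ultimately have 1: "2 ^ n * (exp (- l * t) * d n t) \<le> r powr (1 / p)" by simp
        have "2 ^ n * d n t = exp (l * t) * (2 ^ n * (exp (- l * t) * d n t))"
          by (simp add: exp_minus)
        also have "\<dots> \<le> exp (l * T) * r powr (1 / p)"
          using elim(2) l d0 by (intro mult_mono 1) auto
        also have "\<dots> = W t" using r by (simp add: W_def)
        finally show "d n t \<le> W t * (1 / 2) ^ n" by (simp add: field_simps)
      qed
    qed
  qed
qed

text \<open>The iterates converge almost everywhere under an L^p majorant, so the limit is in L^p;
  the rate 2 * W t * (1 / 2) ^ n, pushed through the Lipschitz estimate, gives convergence of the
  integral terms.\<close>

lemma solution_exists:
  assumes \<eta>: "\<eta> \<in> Lp T p" and u: "u \<in> controls T p u0"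
  obtains y where "y \<in> Lp T p" "solves T f \<eta> u y"
proof -
  define F where "F y = (\<lambda>t. \<eta> t + V y u t)" for y
  \<comment> \<open>Starting at \<eta> makes the initial increment \<open>d 0\<close> the norm of
    \<open>V \<eta> u\<close>, which is in L^p.\<close>
  define x where "x n = (F ^^ n) \<eta>" for n
  have xS: "x (Suc n) = F (x n)" for n by (simp add: x_def)
  have xLp: "x n \<in> Lp T p" for n
  proof (induction n)
    case 0
    show ?case using \<eta> by (simp add: x_def)
  next
    case (Suc n)
    show ?case unfolding xS F_def by (intro Lp_add \<eta> V_Lp Suc u)
  qed
  define d where "d n t = norm (x (Suc n) t - x n t)" for n t
  have dm: "d n \<in> borel_measurable M" for n
    using Lp_measurable[OF xLp] unfolding d_def by measurable
  have dL: "d 0 \<in> Lp T p" unfolding d_def by (intro Lp_norm_fun Lp_diff xLp)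
  have step: "AE t in M. ennreal (d (Suc n) t) \<le> sing_pot T (1 - \<beta>) (\<lambda>s. L s * d n s) t" for n
    using AE_V_lipschitz[OF xLp[of "Suc n"] xLp[of n] u] by (simp add: d_def xS F_def)
  have d0: "0 \<le> d n t" for n t by (simp add: d_def)
  obtain W where W: "W \<in> Lp T p" "\<And>t. 0 \<le> W t" "AE t in M. \<forall>n. d n t \<le> W t * (1 / 2) ^ n"
    using picard_majorant[OF dm d0 dL step] by blast
  \<comment> \<open>Where the iterates diverge, on a null set by the majorant, \<open>lim\<close>
    has an unspecified value.\<close>
  define y where "y t = lim (\<lambda>n. x n t)" for t
  have lim: "AE t in M. (\<lambda>n. x n t) \<longlonglongrightarrow> y t \<and> (\<forall>n. norm (y t - x n t) \<le> 2 * W t * (1 / 2) ^ n)"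
    using W(3)
  proof eventually_elim
    case (elim t)
    then show ?case
      using geometric_steps_convergent[of "\<lambda>n. x n t" "W t"] by (auto simp: d_def y_def)
  qed
  have ym: "y \<in> borel_measurable M"
    unfolding y_def using Lp_measurable[OF xLp] by (intro borel_measurable_lim_metric) auto
  have W2: "(\<lambda>t. W t + W t) \<in> Lp T p" by (intro Lp_add W)
  have "(\<lambda>t. y t - x 0 t) \<in> Lp T p"
  proof (rule Lp_dominated[OF _ W2])
    show "(\<lambda>t. y t - x 0 t) \<in> borel_measurable M"
      using ym Lp_measurable[OF xLp] by measurable
    show "AE t in M. norm (y t - x 0 t) \<le> W t + W t"
      using lim
    proof eventually_elim
      case (elim t)
      then have "norm (y t - x 0 t) \<le> 2 * W t * (1 / 2) ^ 0" by blast
      then show ?case by simp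
    qed
  qed
  from Lp_add[OF this xLp[of 0]] have yL: "y \<in> Lp T p" by simp
  \<comment> \<open>Countably many exceptional sets are united, so that one \<open>t\<close> can be
    fixed for all \<open>n\<close>.\<close>
  have "AE t in M. \<forall>n. ennreal (norm (V y u t - V (x n) u t)) \<le> sing_pot T (1 - \<beta>) (\<lambda>s. L s * norm (y s - x n s)) t"
    unfolding AE_all_countable by (intro allI AE_V_lipschitz yL xLp u)
  moreover have "AE t in M. \<forall>n. sing_pot T (1 - \<beta>) (\<lambda>s. L s * norm (y s - x n s)) t
      \<le> ennreal ((1 / 2) ^ n) * sing_pot T (1 - \<beta>) (\<lambda>s. L s * (W s + W s)) t"
  proof (rule AE_I2, rule allI)
    fix t n
    have "AE s in M. L s * norm (y s - x n s) \<le> (1 / 2) ^ n * (L s * (W s + W s))"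
      using lim AE_M_Icc
    proof eventually_elim
      case (elim s)
      have "L s * norm (y s - x n s) \<le> L s * (2 * W s * (1 / 2) ^ n)"
        using elim L_nonneg by (intro mult_left_mono) auto
      then show ?case by (simp add: algebra_simps)
    qed
    then have "sing_pot T (1 - \<beta>) (\<lambda>s. L s * norm (y s - x n s)) t
      \<le> sing_pot T (1 - \<beta>) (\<lambda>s. (1 / 2) ^ n * (L s * (W s + W s))) t"
      by (rule sing_pot_mono_AE)
    also have "\<dots> \<le> ennreal ((1 / 2) ^ n) * sing_pot T (1 - \<beta>) (\<lambda>s. L s * (W s + W s)) t"
      using Lp_measurable[OF W(1)] by (intro sing_pot_cmult_le) auto
    finally show "sing_pot T (1 - \<beta>) (\<lambda>s. L s * norm (y s - x n s)) t
      \<le> ennreal ((1 / 2) ^ n) * sing_pot T (1 - \<beta>) (\<lambda>s. L s * (W s + W s)) t" .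
  qed
  moreover have "AE t in M. sing_pot T (1 - \<beta>) (\<lambda>s. L s * (W s + W s)) t < \<infinity>"
    using W(2) by (intro AE_pot_Lp_finite W2) auto
  moreover note lim AE_set_integrable[OF yL u]
  ultimately have "AE t in M. set_integrable lebesgue {0..<t} (\<lambda>s. f t s (y s) (u s)) \<and> y t = \<eta> t + V y u t"
  proof eventually_elim
    case (elim t)
    obtain P where P: "sing_pot T (1 - \<beta>) (\<lambda>s. L s * (W s + W s)) t = ennreal P" "0 \<le> P"
      using elim(3) by (cases "sing_pot T (1 - \<beta>) (\<lambda>s. L s * (W s + W s)) t") auto
    have bd: "norm (V (x n) u t - V y u t) \<le> (1 / 2) ^ n * P" for n
    proof -
      have "ennreal (norm (V y u t - V (x n) u t)) \<le> ennreal ((1 / 2) ^ n) * ennreal P"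
        using order_trans[OF elim(1)[rule_format] elim(2)[rule_format, of n]] P by simp
      also have "\<dots> = ennreal ((1 / 2) ^ n * P)" using P by (simp add: ennreal_mult)
      finally show ?thesis using P by (simp add: norm_minus_commute)
    qed
    have "(\<lambda>n. (1 / 2) ^ n * P) \<longlonglongrightarrow> 0"
      by (rule tendsto_mult_left_zero) (rule LIMSEQ_power_zero, simp)
    then have "(\<lambda>n. V (x n) u t - V y u t) \<longlonglongrightarrow> 0"
      by (rule Lim_null_comparison[OF always_eventually, OF allI, OF bd])
    then have "(\<lambda>n. \<eta> t + V (x n) u t) \<longlonglongrightarrow> \<eta> t + V y u t"
      by (intro tendsto_add tendsto_const) (rule LIM_zero_cancel)
    then have "(\<lambda>n. x (Suc n) t) \<longlonglongrightarrow> \<eta> t + V y u t" by (simp add: xS F_def)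
    moreover have "(\<lambda>n. x (Suc n) t) \<longlonglongrightarrow> y t" using elim(4) by (intro LIMSEQ_Suc) simp
    ultimately show ?case using elim(5) by (simp add: LIMSEQ_unique)
  qed
  then show thesis using that yL by (simp add: solves_iff)
qed

section \<open>Stability, uniqueness and the a priori bound\<close>

text \<open>Kept in p-th powers, the form that Gronwall delivers; uniqueness and the norm estimate
  are both read off from it.\<close>

definition stability_const :: "real \<Rightarrow> bool" where
  "stability_const C \<longleftrightarrow> 0 < C \<and> (\<forall>\<eta>1 \<eta>2 u1 u2 y1 y2. \<eta>1 \<in> Lp T p \<longrightarrow> \<eta>2 \<in> Lp T p \<longrightarrow>
      u1 \<in> controls T p u0 \<longrightarrow> u2 \<in> controls T p u0 \<longrightarrow> y1 \<in> Lp T p \<longrightarrow> y2 \<in> Lp T p \<longrightarrow>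
      (AE t in M. y1 t = \<eta>1 t + V y1 u1 t) \<longrightarrow> (AE t in M. y2 t = \<eta>2 t + V y2 u2 t) \<longrightarrow>
      (\<integral>\<^sup>+t. norm (y1 t - y2 t) powr p \<partial>M)
       \<le> ennreal C * ((\<integral>\<^sup>+t. norm (\<eta>1 t - \<eta>2 t) powr p \<partial>M) + (\<integral>\<^sup>+t. DV y1 u1 u2 t powr p \<partial>M)))"

lemmas stability_const_pos = stability_const_def[THEN iffD1, THEN conjunct1]
lemmas stability_const_le = stability_const_def[THEN iffD1, THEN conjunct2, rule_format]

lemma solution_stability: "\<exists>C. stability_const C"
proof -
  obtain C where "Gronwall_const C" using singular_Gronwall ..
  note Cpos = Gronwall_const_pos[OF this] and C = Gronwall_const_le[OF this]
  show ?thesis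
    unfolding stability_const_def
  proof (intro exI[of _ "C * 2 powr p"] conjI allI impI)
    show "C * 2 powr p > 0" using Cpos by simp
    fix \<eta>1 \<eta>2 :: "real \<Rightarrow> real ^ 'n" and u1 u2 :: "real \<Rightarrow> 'u" and y1 y2 :: "real \<Rightarrow> real ^ 'n"
    assume \<eta>: "\<eta>1 \<in> Lp T p" "\<eta>2 \<in> Lp T p" and u: "u1 \<in> controls T p u0" "u2 \<in> controls T p u0"
      and y: "y1 \<in> Lp T p" "y2 \<in> Lp T p"
      and sol: "AE t in M. y1 t = \<eta>1 t + V y1 u1 t" "AE t in M. y2 t = \<eta>2 t + V y2 u2 t"
    note [measurable] = Lp_measurable[OF \<eta>(1)] Lp_measurable[OF \<eta>(2)] Lp_measurable[OF y(1)] Lp_measurable[OF y(2)]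
       DV_measurable[OF y(1) u]
    have "(\<integral>\<^sup>+t. norm (y1 t - y2 t) powr p \<partial>M) \<le> ennreal C * (\<integral>\<^sup>+t. (norm (\<eta>1 t - \<eta>2 t) + DV y1 u1 u2 t) powr p \<partial>M)"
    proof (rule C)
      show "(\<integral>\<^sup>+t. norm (y1 t - y2 t) powr p \<partial>M) < \<infinity>" by (intro Lp_nn_integral Lp_diff y)
      show "AE t in M. ennreal (norm (y1 t - y2 t)) \<le> ennreal (norm (\<eta>1 t - \<eta>2 t) + DV y1 u1 u2 t)
          + sing_pot T (1 - \<beta>) (\<lambda>s. L s * norm (y1 s - y2 s)) t"
        using sol AE_DV[OF y(1) u] AE_V_lipschitz[OF y u(2)]
      proof eventually_elim
        case (elim t)
        \<comment> \<open>The intermediate term \<open>V y1 u2\<close> changes the control first, at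
          the state \<open>y1\<close>, which gives \<open>DV\<close>, and then the state under
          \<open>u2\<close>, which gives a potential.\<close>
        have "y1 t - y2 t = (\<eta>1 t - \<eta>2 t) + (V y1 u1 t - V y1 u2 t) + (V y1 u2 t - V y2 u2 t)"
          using elim(1,2) by (simp add: algebra_simps)
        then have "norm (y1 t - y2 t) \<le> norm (\<eta>1 t - \<eta>2 t) + norm (V y1 u1 t - V y1 u2 t) + norm (V y1 u2 t - V y2 u2 t)"
          using norm_triangle_ineq[of "(\<eta>1 t - \<eta>2 t) + (V y1 u1 t - V y1 u2 t)" "V y1 u2 t - V y2 u2 t"]
            norm_triangle_ineq[of "\<eta>1 t - \<eta>2 t" "V y1 u1 t - V y1 u2 t"] by simp
        also have "\<dots> \<le> (norm (\<eta>1 t - \<eta>2 t) + DV y1 u1 u2 t) + norm (V y1 u2 t - V y2 u2 t)"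
          using elim(3) by simp
        finally have "ennreal (norm (y1 t - y2 t)) \<le> ennreal (norm (\<eta>1 t - \<eta>2 t) + DV y1 u1 u2 t) + ennreal (norm (V y1 u2 t - V y2 u2 t))"
          using DV_nonneg[of y1 u1 u2 t] by (simp add: ennreal_leI flip: ennreal_plus)
        also have "\<dots> \<le> ennreal (norm (\<eta>1 t - \<eta>2 t) + DV y1 u1 u2 t) + sing_pot T (1 - \<beta>) (\<lambda>s. L s * norm (y1 s - y2 s)) t"
          by (intro add_left_mono elim(4))
        finally show ?case .
      qed
    qed (auto simp: DV_nonneg intro!: add_nonneg_nonneg)
    also have "\<dots> \<le> ennreal C * (ennreal (2 powr p) * ((\<integral>\<^sup>+t. norm (\<eta>1 t - \<eta>2 t) powr p \<partial>M) + (\<integral>\<^sup>+t. DV y1 u1 u2 t powr p \<partial>M)))"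
      by (intro mult_left_mono nn_integral_powr_add_le DV_nonneg) auto
    also have "\<dots> = ennreal (C * 2 powr p) * ((\<integral>\<^sup>+t. norm (\<eta>1 t - \<eta>2 t) powr p \<partial>M) + (\<integral>\<^sup>+t. DV y1 u1 u2 t powr p \<partial>M))"
      using Cpos by (subst ennreal_mult) (auto simp: mult.assoc)
    finally show "(\<integral>\<^sup>+t. norm (y1 t - y2 t) powr p \<partial>M)
       \<le> ennreal (C * 2 powr p) * ((\<integral>\<^sup>+t. norm (\<eta>1 t - \<eta>2 t) powr p \<partial>M) + (\<integral>\<^sup>+t. DV y1 u1 u2 t powr p \<partial>M))" .
  qed
qed

lemma solves_AE: "solves T f \<eta> u y \<Longrightarrow> AE t in M. y t = \<eta> t + V y u t"
  unfolding solves_iff by (auto elim: eventually_mono)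

text \<open>Equal data make the right side of the stability bound vanish.\<close>

lemma solution_unique:
  assumes \<eta>: "\<eta> \<in> Lp T p" and u: "u \<in> controls T p u0" and y: "y \<in> Lp T p" "z \<in> Lp T p"
    and sol: "solves T f \<eta> u y" "solves T f \<eta> u z"
  shows "AE t in M. z t = y t"
proof -
  obtain C where "stability_const C" using solution_stability ..
  note C = stability_const_le[OF this]
  note C = C[OF \<eta> \<eta> u u y(2,1) solves_AE[OF sol(2)] solves_AE[OF sol(1)]]
  have "DV z u u t = 0" for t by (simp add: DV_def set_lebesgue_integral_def)
  with C have "(\<integral>\<^sup>+t. norm (z t - y t) powr p \<partial>M) = 0" by simp
  then have "AE t in M. ennreal (norm (z t - y t) powr p) = 0"
    using Lp_measurable[OF Lp_diff[OF y(2,1)]] by (subst (asm) nn_integral_0_iff_AE) auto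
  then show ?thesis by eventually_elim simp
qed

lemma stability_norm:
  "\<exists>K > 0. \<forall>\<eta>1 \<in> Lp T p. \<forall>\<eta>2 \<in> Lp T p. \<forall>u1 \<in> controls T p u0. \<forall>u2 \<in> controls T p u0.
     \<forall>y1 \<in> Lp T p. \<forall>y2 \<in> Lp T p. solves T f \<eta>1 u1 y1 \<longrightarrow> solves T f \<eta>2 u2 y2 \<longrightarrow>
       Lp_norm T p (\<lambda>t. y1 t - y2 t) \<le> K * (Lp_norm T p (\<lambda>t. \<eta>1 t - \<eta>2 t) + Lp_norm T p (DV y1 u1 u2))"
proof -
  obtain C where "stability_const C" using solution_stability ..
  note Cpos = stability_const_pos[OF this] and C = stability_const_le[OF this]
  show ?thesis
  proof (intro exI[of _ "(2 * C) powr (1 / p)"] conjI ballI impI)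
    show "(2 * C) powr (1 / p) > 0" using Cpos by simp
    fix \<eta>1 \<eta>2 :: "real \<Rightarrow> real ^ 'n" and u1 u2 :: "real \<Rightarrow> 'u" and y1 y2 :: "real \<Rightarrow> real ^ 'n"
    assume a: "\<eta>1 \<in> Lp T p" "\<eta>2 \<in> Lp T p" "u1 \<in> controls T p u0" "u2 \<in> controls T p u0" "y1 \<in> Lp T p" "y2 \<in> Lp T p"
      and sol: "solves T f \<eta>1 u1 y1" "solves T f \<eta>2 u2 y2"
    let ?a = "Lp_norm T p (\<lambda>t. y1 t - y2 t)" and ?b = "Lp_norm T p (\<lambda>t. \<eta>1 t - \<eta>2 t)" and ?c = "Lp_norm T p (DV y1 u1 u2)"
    have "(\<integral>\<^sup>+t. DV y1 u1 u2 t powr p \<partial>M) = ennreal (?c powr p)"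
      using Lp_norm_powr[OF DV_Lp[OF a(5,3,4)]] by (simp add: DV_nonneg)
    with C[OF a solves_AE[OF sol(1)] solves_AE[OF sol(2)]]
    have "ennreal (?a powr p) \<le> ennreal C * (ennreal (?b powr p) + ennreal (?c powr p))"
      by (simp only: Lp_norm_powr[OF Lp_diff[OF a(5,6)]] Lp_norm_powr[OF Lp_diff[OF a(1,2)]])
    then have "?a powr p \<le> C * (?b powr p + ?c powr p)"
      using Cpos by (simp flip: ennreal_plus ennreal_mult)
    then show "?a \<le> (2 * C) powr (1 / p) * (?b + ?c)"
      using Cpos p by (intro le_root_mult_add Lp_norm_nonneg) auto
  qed
qed

text \<open>The integral term at the state 0 is bounded by the growth condition, independently of
  \<open>y\<close>; the remainder is dominated by the potential of \<open>L\<close> times the norm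
  of \<open>y\<close>, as Gronwall requires.\<close>

lemma a_priori_bound:
  "\<exists>C>0. \<forall>\<eta> \<in> Lp T p. \<forall>u \<in> controls T p u0. \<forall>y \<in> Lp T p. solves T f \<eta> u y \<longrightarrow>
     Lp_norm T p y \<le> C * (Lp_norm T p \<eta> + (1 + Lp_norm T p (\<lambda>t. dist (u t) u0)))"
proof -
  obtain C where "Gronwall_const C" using singular_Gronwall ..
  note Cpos = Gronwall_const_pos[OF this] and C = Gronwall_const_le[OF this]
  obtain B where "NV_bounded B" using ex_NV_bounded ..
  note Bpos = NV_bounded_pos[OF this] and B = NV_bounded_le[OF this]
  \<comment> \<open>Gronwall contributes \<open>C\<close>, splitting the sum 2 powr p, and 1 + 2 * B
    covers the coefficient 1 of the \<eta> term and 2 * B of the control term at once.\<close>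
  define A where "A = C * 2 powr p * (1 + 2 * B)"
  have A: "A > 0" using Cpos Bpos by (simp add: A_def)
  show ?thesis
  proof (intro exI[of _ "(2 * A) powr (1 / p)"] conjI ballI impI)
    show "(2 * A) powr (1 / p) > 0" using A by simp
    fix \<eta> :: "real \<Rightarrow> real ^ 'n" and u :: "real \<Rightarrow> 'u" and y :: "real \<Rightarrow> real ^ 'n"
    assume \<eta>: "\<eta> \<in> Lp T p" and u: "u \<in> controls T p u0" and y: "y \<in> Lp T p" and sol: "solves T f \<eta> u y"
    let ?z = "\<lambda>_::real. 0 :: real ^ 'n"
    let ?a = "Lp_norm T p y" and ?b = "Lp_norm T p \<eta>" and ?c = "Lp_norm T p (\<lambda>t. dist (u t) u0)"
    have z: "?z \<in> Lp T p" using p by (simp add: Lp_def)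
    note [measurable] = Lp_measurable[OF \<eta>] Lp_measurable[OF y] V_measurable[OF z u]
    have "ennreal (?a powr p) = (\<integral>\<^sup>+t. norm (y t) powr p \<partial>M)" by (rule Lp_norm_powr[OF y, symmetric])
    also have "\<dots> \<le> ennreal C * (\<integral>\<^sup>+t. (norm (\<eta> t) + norm (V ?z u t)) powr p \<partial>M)"
    proof (rule C)
      show "(\<integral>\<^sup>+t. norm (y t) powr p \<partial>M) < \<infinity>" by (intro Lp_nn_integral y)
      show "AE t in M. ennreal (norm (y t)) \<le> ennreal (norm (\<eta> t) + norm (V ?z u t)) + sing_pot T (1 - \<beta>) (\<lambda>s. L s * norm (y s)) t"
        using solves_AE[OF sol] AE_V_lipschitz[OF y z u]
      proof eventually_elim
        case (elim t)
        have "y t = \<eta> t + V ?z u t + (V y u t - V ?z u t)" using elim(1) by simp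
        then have "norm (y t) \<le> norm (\<eta> t) + norm (V ?z u t) + norm (V y u t - V ?z u t)"
          using norm_triangle_ineq[of "\<eta> t + V ?z u t" "V y u t - V ?z u t"] norm_triangle_ineq[of "\<eta> t" "V ?z u t"] by simp
        then have "ennreal (norm (y t)) \<le> ennreal (norm (\<eta> t) + norm (V ?z u t)) + ennreal (norm (V y u t - V ?z u t))"
          by (simp add: ennreal_leI flip: ennreal_plus)
        also have "\<dots> \<le> ennreal (norm (\<eta> t) + norm (V ?z u t)) + sing_pot T (1 - \<beta>) (\<lambda>s. L s * norm (y s)) t"
          using elim(2) by (intro add_left_mono) simp
        finally show ?case .
      qed
    qed auto
    also have "\<dots> \<le> ennreal C * (ennreal (2 powr p) * (ennreal (?b powr p) + ennreal B * (1 + ennreal (?c powr p))))"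
    proof (rule mult_left_mono)
      have "(\<integral>\<^sup>+t. (norm (\<eta> t) + norm (V ?z u t)) powr p \<partial>M)
          \<le> ennreal (2 powr p) * ((\<integral>\<^sup>+t. norm (\<eta> t) powr p \<partial>M) + (\<integral>\<^sup>+t. norm (V ?z u t) powr p \<partial>M))"
        by (intro nn_integral_powr_add_le) auto
      also have "\<dots> \<le> ennreal (2 powr p) * (ennreal (?b powr p) + ennreal B * (1 + ennreal (?c powr p)))"
      proof (intro mult_left_mono add_mono)
        show "(\<integral>\<^sup>+t. norm (\<eta> t) powr p \<partial>M) \<le> ennreal (?b powr p)" by (simp only: Lp_norm_powr[OF \<eta>])
        have "(\<integral>\<^sup>+t. norm (V ?z u t) powr p \<partial>M) \<le> ennreal B * (1 + (\<integral>\<^sup>+t. (norm (?z t) + dist (u t) u0) powr p \<partial>M))"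
          using nn_integral_norm_V_le[OF z u] B[OF z u] by (rule order_trans)
        also have "(\<integral>\<^sup>+t. (norm (?z t) + dist (u t) u0) powr p \<partial>M) = ennreal (?c powr p)"
          using Lp_norm_powr[OF controlsD(2)[OF u]] by simp
        finally show "(\<integral>\<^sup>+t. norm (V ?z u t) powr p \<partial>M) \<le> ennreal B * (1 + ennreal (?c powr p))" .
      qed auto
      finally show "(\<integral>\<^sup>+t. (norm (\<eta> t) + norm (V ?z u t)) powr p \<partial>M)
        \<le> ennreal (2 powr p) * (ennreal (?b powr p) + ennreal B * (1 + ennreal (?c powr p)))" .
    qed auto
    also have "\<dots> = ennreal (C * (2 powr p * (?b powr p + B * (1 + ?c powr p))))"
      using Cpos Bpos by (simp add: ennreal_mult)
    finally have "?a powr p \<le> C * (2 powr p * (?b powr p + B * (1 + ?c powr p)))"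
      using Cpos Bpos by (subst (asm) ennreal_le_iff) auto
    \<comment> \<open>Both 1 and ?c powr p are at most (1 + ?c) powr p; this shapes the control term
      for \<open>le_root_mult_add\<close>.\<close>
    also have "\<dots> \<le> C * (2 powr p * (?b powr p + B * (2 * (1 + ?c) powr p)))"
    proof -
      have "1 \<le> (1 + ?c) powr p" using Lp_norm_nonneg p by (intro ge_one_powr_ge_zero) auto
      moreover have "?c powr p \<le> (1 + ?c) powr p" using Lp_norm_nonneg p by (intro powr_mono2) auto
      ultimately have "1 + ?c powr p \<le> 2 * (1 + ?c) powr p" by simp
      then show ?thesis using Cpos Bpos by (intro mult_left_mono add_left_mono) auto
    qed
    also have "\<dots> \<le> A * (?b powr p + (1 + ?c) powr p)"
    proof -
      have "?b powr p + B * (2 * (1 + ?c) powr p) \<le> (1 + 2 * B) * (?b powr p + (1 + ?c) powr p)"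
        using Bpos by (simp add: algebra_simps)
      then show ?thesis unfolding A_def mult.assoc using Cpos by (intro mult_left_mono) auto
    qed
    finally show "?a \<le> (2 * A) powr (1 / p) * (?b + (1 + ?c))"
      using A p by (intro le_root_mult_add add_nonneg_nonneg Lp_norm_nonneg) auto
  qed
qed

end

theorem theorem3p1:
  fixes T p \<beta> :: real
    and u0 :: "'u::{metric_space, second_countable_topology}"
    and f :: "real \<Rightarrow> real \<Rightarrow> real ^ 'n \<Rightarrow> 'u \<Rightarrow> real ^ 'n"
    and L L0 :: "real \<Rightarrow> real"
  assumes T: "T > 0"
    and p: "p \<ge> 1"
    and \<beta>: "0 < \<beta>" "\<beta> < 1"
    and f_meas: "(\<lambda>((t, s), y, u). f t s y u)
        \<in> borel_measurable (lebesgue_on (Delta T) \<Otimes>\<^sub>M (borel \<Otimes>\<^sub>M borel))"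
    and L_nonneg: "\<And>s. s \<in> {0..T} \<Longrightarrow> L s \<ge> 0"
    and L0_nonneg: "\<And>s. s \<in> {0..T} \<Longrightarrow> L0 s \<ge> 0"
    and L: "L \<in> Lp_plus T (max (ereal (1 / \<beta>)) (conj_exponent p))"
    and L0: "L0 \<in> Lp_plus T (ereal (max (p / (1 + \<beta> * p)) 1))"
    and f_lipschitz: "\<And>t s u y1 y2. (t, s) \<in> Delta T \<Longrightarrow>
        norm (f t s y1 u - f t s y2 u) \<le> L s * norm (y1 - y2) / (t - s) powr (1 - \<beta>)"
    and f_growth: "\<And>t s u. (t, s) \<in> Delta T \<Longrightarrow>
        norm (f t s 0 u) \<le> (L s * dist u u0 + L0 s) / (t - s) powr (1 - \<beta>)"
  shows "(\<forall>\<eta> \<in> Lp T p. \<forall>u \<in> controls T p u0.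
            \<exists>y \<in> Lp T p. solves T f \<eta> u y \<and>
              (\<forall>z \<in> Lp T p. solves T f \<eta> u z \<longrightarrow> (AE t in lebesgue_on {0..T}. z t = y t)))
       \<and> (\<forall>R. \<exists>K > 0. \<forall>\<eta> \<in> Lp T p. \<forall>u \<in> controls T p u0. \<forall>y \<in> Lp T p.
            Lp_norm T p \<eta> \<le> R \<longrightarrow> solves T f \<eta> u y \<longrightarrow>
              Lp_norm T p y \<le> Lp_norm T p \<eta> + K * (1 + Lp_norm T p (\<lambda>t. dist (u t) u0)))
       \<and> (\<exists>K > 0. \<forall>\<eta>1 \<in> Lp T p. \<forall>\<eta>2 \<in> Lp T p.
            \<forall>u1 \<in> controls T p u0. \<forall>u2 \<in> controls T p u0.
            \<forall>y1 \<in> Lp T p. \<forall>y2 \<in> Lp T p.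
            solves T f \<eta>1 u1 y1 \<longrightarrow> solves T f \<eta>2 u2 y2 \<longrightarrow>
              Lp_norm T p (\<lambda>t. y1 t - y2 t) \<le>
                K * (Lp_norm T p (\<lambda>t. \<eta>1 t - \<eta>2 t) +
                  (LINT t|lebesgue_on {0..T}.
                     (LINT s:{0..<t}|lebesgue.
                        norm (f t s (y1 s) (u1 s) - f t s (y1 s) (u2 s))) powr p) powr (1 / p)))"
proof -
  interpret volterra T p \<beta> u0 f L L0
    by (rule volterra.intro) (fact assms)+
  have exun: "\<exists>y \<in> Lp T p. solves T f \<eta> u y \<and>
      (\<forall>z \<in> Lp T p. solves T f \<eta> u z \<longrightarrow> (AE t in lebesgue_on {0..T}. z t = y t))"
    if \<eta>: "\<eta> \<in> Lp T p" and u: "u \<in> controls T p u0" for \<eta> u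
  proof -
    obtain y where y: "y \<in> Lp T p" "solves T f \<eta> u y" using solution_exists[OF \<eta> u] .
    then show ?thesis using solution_unique[OF \<eta> u y(1) _ y(2)] by blast
  qed
  have bound: "\<exists>K > 0. \<forall>\<eta> \<in> Lp T p. \<forall>u \<in> controls T p u0. \<forall>y \<in> Lp T p.
      Lp_norm T p \<eta> \<le> R \<longrightarrow> solves T f \<eta> u y \<longrightarrow>
      Lp_norm T p y \<le> Lp_norm T p \<eta> + K * (1 + Lp_norm T p (\<lambda>t. dist (u t) u0))" for R
  proof -
    obtain C where C: "C > 0" "\<forall>\<eta> \<in> Lp T p. \<forall>u \<in> controls T p u0. \<forall>y \<in> Lp T p. solves T f \<eta> u y \<longrightarrow>
        Lp_norm T p y \<le> C * (Lp_norm T p \<eta> + (1 + Lp_norm T p (\<lambda>t. dist (u t) u0)))"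
      using a_priori_bound by (elim exE conjE)
    show ?thesis
    \<comment> \<open>Since 1 + ?c \<ge> 1, the norm ?b is at most max R 0 * (1 + ?c), so
      \<open>C * ?b\<close> moves into the control term, and the nonnegative ?b is then added on the
      right. The maximum keeps the constant positive for negative \<open>R\<close>.\<close>
    proof (intro exI[of _ "C * (max R 0 + 1)"] conjI ballI impI)
      show "C * (max R 0 + 1) > 0" using C(1) by (simp add: add_nonneg_pos)
      fix \<eta> u y
      assume \<eta>: "\<eta> \<in> Lp T p" and u: "u \<in> controls T p u0" and y: "y \<in> Lp T p"
        and R: "Lp_norm T p \<eta> \<le> R" and sol: "solves T f \<eta> u y"
      let ?b = "Lp_norm T p \<eta>" and ?c = "Lp_norm T p (\<lambda>t. dist (u t) u0)"
      have nn: "0 \<le> ?b" "0 \<le> ?c" by (rule Lp_norm_nonneg)+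
      have "Lp_norm T p y \<le> C * (?b + (1 + ?c))" using C(2) \<eta> u y sol by (elim ballE impE) auto
      also have "\<dots> \<le> C * ((max R 0 + 1) * (1 + ?c))"
      proof (rule mult_left_mono)
        have "?b \<le> max R 0 * 1" using R by simp
        also have "\<dots> \<le> max R 0 * (1 + ?c)" using nn by (intro mult_left_mono) auto
        finally show "?b + (1 + ?c) \<le> (max R 0 + 1) * (1 + ?c)" by (simp add: distrib_right)
      qed (use C(1) in simp)
      also have "\<dots> \<le> ?b + C * (max R 0 + 1) * (1 + ?c)" using nn by (simp add: mult.assoc)
      finally show "Lp_norm T p y \<le> ?b + C * (max R 0 + 1) * (1 + ?c)" .
    qed
  qed
  \<comment> \<open>As \<open>DV\<close> is nonnegative, the absolute value inside its L^p norm
    disappears and the literal double integral of the claim remains.\<close>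
  have DV: "Lp_norm T p (DV y u v) = (LINT t|lebesgue_on {0..T}. (LINT s:{0..<t}|lebesgue.
      norm (f t s (y s) (u s) - f t s (y s) (v s))) powr p) powr (1 / p)" for y u v
    unfolding Lp_norm_def real_norm_def abs_of_nonneg[OF DV_nonneg] by (simp only: DV_def)
  show ?thesis
    using exun bound stability_norm[unfolded DV] by (intro conjI ballI allI)
qed

end
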